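(* Let $\phi_{\rm gen}$ be a generic polyhedral polynomial and let $M$ be the Minkowski sum of its coefficients. Fix a vertex $v$ of $M$. A polyhedron $P_0$ with vertex set $V$ is a $v$-local Minkowski-Weyl minimal solution to $\phi_{\rm gen}$ if and only if there is a local compatible system $(\mathcal{C},\mathcal{I})$ of $\phi_{\rm gen}$ at $v$, where $\mathcal{C}=\{C_k\}_{k=1}^{t}$ and $\mathcal{I}=\{(i_k,j_k)\}_{k=1}^{t}$, such that $V=\{\rho^{(v)}_{i_k,j_k}\}_{k=1}^t$ and $P_0$ is the associated polyhedron of the restriction of $(\mathcal{C},\mathcal{I})$ to a maximal polyhedral convex subset (i.e. a maximal convex polyhedral subcone) of $\cup_{k=1}^{t}C_k$.
   Context: Semirings. Fix $n\ge 1$ and $\omega\in(\mathbb{R}^n)^\star$ whose coordinates are linearly independent over $\mathbb{Q}$. A nonempty polyhedron $P\subset\mathbb{R}^n$ is $\omega$-positive if $\min_{x\in P}\omega(x)$ exists. $\mathcal{P}_\omega$ is the semiring of all $\omega$-positive rational polyhedra together with an extra element $0$, with addition $\oplus$ = (closed) convex hull of the union, multiplication $\odot$ = Minkowski sum, $P\oplus 0=P$, $P\odot 0=0$. A polyhedral semiring $\mathcal{A}$ is a semiring with additive and multiplicative identity embedded as a sub-semiring in some $\mathcal{P}_\omega$. Polynomials. A polyhedral polynomial is $\phi=\oplus_{i\in{\rm Supp}(\phi)}(Q_i\odot Y^i)$ with ${\rm Supp}(\phi)=\{i_0<\dots<i_{r+1}\}\subset\mathbb{Z}_{\ge0}$ finite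 with at least two elements, and $Q_i\in\mathcal{A}\setminus\{0\}$. $M:=\odot_{i}Q_i$. For a polyhedron $P$ and a vertex $\gamma$ of $P$, $N_P(\gamma)=\{\ell\in(\mathbb{R}^n)^\star : \ell(\gamma)\le\ell(x)\ \forall x\in P\}$ is the inner normal cone, and $N(P)$ is the union of the inner normal cones of all vertices of $P$. Each vertex $\nu$ of $M$ has a unique Minkowski decomposition $\nu=\sum_{i\in{\rm Supp}(\phi)}\nu_i$ with $\nu_i$ a vertex of $Q_i$. For distinct $i,j\in{\rm Supp}(\phi)$ put $\rho^{(\nu)}_{i,j}:=-(\nu_i-\nu_j)/(i-j)$. $\phi$ is generic if for every vertex $\nu$ of $M$, $\rho^{(\nu)}_{\hat i,\hat j}=\rho^{(\nu)}_{\tilde i,\tilde j}$ implies $\{\hat i,\hat j\}=\{\tilde i,\tilde j\}$. Solutions. For a polyhedron $P$ (having at least one vertex), the evaluation is $\phi(P)=\oplus_{i}(Q_i\odot P^{\odot i})$, where $P^{\odot i}$ is the $i$-fold Minkowski sum and $Q_0\odot P^{\odot 0}=Q_0$. $P$ is a solution to $\phi$ if every vertex of $\phi(P)$ is a vertex of at least two distinct summands $Q_i\odot P^{\odot i}$. For a vertex $v$ of $M$, a solution $P$ is $v$-local if $N(P)\subseteq N_M(v)$. A $v$-local solution is Minkowski-Weyl minimal if its recession cone is minimal under inclusion among all $v$-local solutions with the same vertex set. The fan $\mathcal{F}_v$. Let $v=\sum_i v_i$ be the Minkowski decomposition of the vertex $v$. For $i,j,\tilde i,\tilde j,k\in{\rm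 Supp}(\phi)$ with $i\ne j$, $\tilde i\neq\tilde j$, let $H^{(1,v)}_{i,j,k}=\{\mu\in(\mathbb{R}^n)^\star:\mu(v_k+k\rho^{(v)}_{i,j})=\mu(v_i+i\rho^{(v)}_{i,j})\}$ and $H^{(2,v)}_{i,j,\tilde i,\tilde j}=\{\mu\in(\mathbb{R}^n)^\star:\mu(\rho^{(v)}_{i,j})=\mu(\rho^{(v)}_{\tilde i,\tilde j})\}$. Those among them that are hyperplanes (not the whole space) form a central hyperplane arrangement $\mathcal{H}_v$; $\mathcal{F}_v$ is the fan obtained by restricting (the fan of) $\mathcal{H}_v$ to the cone $N_M(v)$, so its maximal cones are the $n$-dimensional cones into which the arrangement subdivides $N_M(v)$ (just $N_M(v)$ if there are no such hyperplanes). A maximal cone $C$ of $\mathcal{F}_v$ has primary label $(i,j)$, $i\ne j$, if $\mu(v_i+i\rho^{(v)}_{i,j})\ (=\mu(v_j+j\rho^{(v)}_{i,j}))\le\mu(v_k+k\rho^{(v)}_{i,j})$ for all $k\in{\rm Supp}(\phi)$ and all $\mu\in C$. It has secondary label $(i,j,\tilde i,\tilde j)$ if $\mu(\rho^{(v)}_{i,j})\le\mu(\rho^{(v)}_{\tilde i,\tilde j})$ for all $\mu\in C$. Local compatible system (LCS) of $\phi$ at $v$: a pair $(\mathcal{C},\mathcal{I})$ with $\mathcal{C}=\{C_1,\dots,C_t\}$ a collection of maximal cones of $\mathcal{F}_v$ and $\mathcal{I}=\{(i_1,j_1),\dots,(i_t,j_t)\}$ a corresponding collection of pairs of distinct elements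 of ${\rm Supp}(\phi)$ such that: (1) with $\mathfrak{T}:=\{\rho^{(v)}_{i_k,j_k}\}_{k=1}^t$, for each $\gamma\in\mathfrak{T}$ the set $C_\gamma:=\cup_{\{k:\rho^{(v)}_{i_k,j_k}=\gamma\}}C_k$ is a convex polyhedral cone; (2) for each $k$, $(i_k,j_k)$ is a primary label of $C_k$; (3) for all distinct $\alpha,\beta\in\{1,\dots,t\}$, $(i_\alpha,j_\alpha,i_\beta,j_\beta)$ is a secondary label of $C_\alpha$; (4) whenever $\mathfrak{f}$ is a facet of a unique cone $C_l$ among $C_1,\dots,C_t$ and there is a maximal cone $C$ of $\mathcal{F}_v$, not in $\mathcal{C}$, sharing the facet $\mathfrak{f}$, either $C$ does not have the primary label $(i_l,j_l)$, or there is $\beta\in\{1,\dots,t\}$ such that $(i_l,j_l,i_\beta,j_\beta)$ is not a secondary label of $C$. The support of the LCS is $\cup_{k=1}^tC_k$. Associated polyhedron. For a convex polyhedral subcone $L$ of the support of an LCS, let $\tilde{\mathfrak{T}}$ be the set of $\gamma\in\mathfrak{T}$ such that $C_\gamma\cap L$ is full-dimensional. The associated polyhedron of the restriction of $(\mathcal{C},\mathcal{I})$ to $L$ is the unique polyhedron with vertex set $\tilde{\mathfrak{T}}$ in which each vertex $\gamma\in\tilde{\mathfrak{T}}$ has inner normal cone $C_\gamma\cap L$. *)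

theory Defs
  imports "HOL-Analysis.Analysis" "HOL-Algebra.Ring"
begin

text \<open>
  The space is \<open>real^'n\<close>.  A functional \<open>l\<close> in its dual is represented by its coordinate
  vector, again in \<open>real^'n\<close>, and \<open>l \<bullet> x\<close> is its value at \<open>x\<close>; so normal cones and fans
  are also subsets of \<open>real^'n\<close>.
\<close>

section \<open>Polyhedra\<close>

definition vertices :: "(real^'n) set \<Rightarrow> (real^'n) set" where
  "vertices P = {x. x extreme_point_of P}"

definition rational_polyhedron :: "(real^'n) set \<Rightarrow> bool" where
  "rational_polyhedron P \<longleftrightarrow>
     (\<exists>F :: ((real^'n) \<times> real) set. finite F \<and>
        (\<forall>(a, b)\<in>F. (\<forall>i. a $ i \<in> \<rat>) \<and> b \<in> \<rat>) \<and>
        P = {x. \<forall>(a, b)\<in>F. a \<bullet> x \<le> b})"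

definition inner_normal_cone :: "(real^'n) set \<Rightarrow> real^'n \<Rightarrow> (real^'n) set" where
  "inner_normal_cone P \<gamma> = {l. \<forall>x\<in>P. l \<bullet> \<gamma> \<le> l \<bullet> x}"

definition normal_support :: "(real^'n) set \<Rightarrow> (real^'n) set" where
  "normal_support P = (\<Union>\<gamma>\<in>vertices P. inner_normal_cone P \<gamma>)"

definition recession_cone :: "(real^'n) set \<Rightarrow> (real^'n) set" where
  "recession_cone P = {d. \<forall>x\<in>P. \<forall>t\<ge>0. x + t *\<^sub>R d \<in> P}"

definition polyhedral_cone :: "(real^'n) set \<Rightarrow> bool" where
  "polyhedral_cone K \<longleftrightarrow> polyhedron K \<and> convex_cone K"

definition full_dimensional :: "(real^'n) set \<Rightarrow> bool" where
  "full_dimensional S \<longleftrightarrow> aff_dim S = int CARD('n)"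

definition closed_convex_hull :: "(real^'n) set \<Rightarrow> (real^'n) set" where
  "closed_convex_hull S = closure (convex hull S)"


section \<open>Polyhedral semirings\<close>

definition rationally_independent :: "real^'n \<Rightarrow> bool" where
  "rationally_independent \<omega> \<longleftrightarrow>
     (\<forall>q :: 'n \<Rightarrow> rat. (\<Sum>i\<in>UNIV. of_rat (q i) * \<omega> $ i) = 0 \<longrightarrow> (\<forall>i. q i = 0))"

definition omega_positive :: "real^'n \<Rightarrow> (real^'n) set \<Rightarrow> bool" where
  "omega_positive \<omega> P \<longleftrightarrow> (\<exists>x\<in>P. \<forall>y\<in>P. \<omega> \<bullet> x \<le> \<omega> \<bullet> y)"

text \<open>
  The extra zero element is represented by the empty set: polyhedra in the semiring are
  nonempty, and the closed convex hull of \<open>P \<union> {}\<close> is \<open>P\<close> while \<open>P + {} = {}\<close>.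
  It must not be confused with the set \<open>0 = {0}\<close> of Minkowski addition
  (\<open>HOL-Library.Set_Algebras\<close>), which is the multiplicative identity of the semiring.
\<close>

definition omega_semiring :: "real^'n \<Rightarrow> (real^'n) set ring" where
  "omega_semiring \<omega> =
     \<lparr> carrier = insert {} {P. rational_polyhedron P \<and> omega_positive \<omega> P},
       mult = (\<lambda>P Q. P + Q),
       one = {0},
       zero = {},
       add = (\<lambda>P Q. closed_convex_hull (P \<union> Q)) \<rparr>"

text \<open>
  A sub-semiring need not have the multiplicative identity of the ambient semiring; for
  instance, the polyhedra whose recession cone contains a fixed cone \<open>K\<close> have identity \<open>K\<close>.
\<close>

definition polyhedral_semiring :: "real^'n \<Rightarrow> (real^'n) set ring \<Rightarrow> bool" where
  "polyhedral_semiring \<omega> A \<longleftrightarrow>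
     semiring A \<and>
     carrier A \<subseteq> carrier (omega_semiring \<omega>) \<and>
     \<zero>\<^bsub>A\<^esub> = \<zero>\<^bsub>omega_semiring \<omega>\<^esub> \<and>
     (\<forall>P\<in>carrier A. \<forall>Q\<in>carrier A.
        P \<oplus>\<^bsub>A\<^esub> Q = P \<oplus>\<^bsub>omega_semiring \<omega>\<^esub> Q \<and>
        P \<otimes>\<^bsub>A\<^esub> Q = P \<otimes>\<^bsub>omega_semiring \<omega>\<^esub> Q)"


section \<open>Polyhedral polynomials\<close>

text \<open>A polynomial is given by its coefficients \<open>\<phi> i\<close>, with zero coefficient \<open>{}\<close> off the support.\<close>

definition Supp :: "(nat \<Rightarrow> (real^'n) set) \<Rightarrow> nat set" where
  "Supp \<phi> = {i. \<phi> i \<noteq> {}}"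

definition polyhedral_polynomial ::
    "(real^'n) set ring \<Rightarrow> (nat \<Rightarrow> (real^'n) set) \<Rightarrow> bool" where
  "polyhedral_polynomial A \<phi> \<longleftrightarrow>
     (\<forall>i. \<phi> i \<in> carrier A) \<and> finite (Supp \<phi>) \<and> 2 \<le> card (Supp \<phi>)"

definition coeff_sum :: "(nat \<Rightarrow> (real^'n) set) \<Rightarrow> (real^'n) set" where
  "coeff_sum \<phi> = (\<Sum>i\<in>Supp \<phi>. \<phi> i)"

definition vertex_decomp :: "(nat \<Rightarrow> (real^'n) set) \<Rightarrow> real^'n \<Rightarrow> nat \<Rightarrow> real^'n" where
  "vertex_decomp \<phi> \<nu> =
     (THE f. f \<in> (\<Pi>\<^sub>E i\<in>Supp \<phi>. vertices (\<phi> i)) \<and> \<nu> = (\<Sum>i\<in>Supp \<phi>. f i))"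

lemma vertex_decomp_ex1:
  assumes fin: "finite (Supp \<phi>)" and \<nu>: "\<nu> \<in> vertices (coeff_sum \<phi>)"
  shows "\<exists>!f. f \<in> (\<Pi>\<^sub>E i\<in>Supp \<phi>. vertices (\<phi> i)) \<and> \<nu> = (\<Sum>i\<in>Supp \<phi>. f i)"
proof -
  let ?S = "Supp \<phi>"
  have M: "coeff_sum \<phi> = {sum s ?S |s. \<forall>i\<in>?S. s i \<in> \<phi> i}"
    unfolding coeff_sum_def by (rule set_sum_alt[OF fin])
  have ext: "\<nu> \<notin> open_segment a b" if "a \<in> coeff_sum \<phi>" "b \<in> coeff_sum \<phi>" for a b
    using \<nu> that by (auto simp: vertices_def extreme_point_of_def)
  have swap: "\<nu> - f k + a \<in> coeff_sum \<phi>"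
    if f: "\<forall>i\<in>?S. f i \<in> \<phi> i" "\<nu> = sum f ?S" and k: "k \<in> ?S" "a \<in> \<phi> k" for f k a
  proof -
    have "sum (f(k := a)) ?S = a + sum f (?S - {k})"
      using fin k by (simp add: sum.remove[of _ k])
    also have "\<dots> = \<nu> - f k + a"
      using fin k f by (simp add: sum.remove[of _ k])
    finally show ?thesis
      using f k unfolding M by (intro CollectI exI[of _ "f(k := a)"]) auto
  qed
  have shift: "x \<in> open_segment (x - y + a) (x - y + b)" if "y \<in> open_segment a b"
    for x y a b :: "real^'n"
  proof -
    have "(x - y) + y \<in> open_segment ((x - y) + a) ((x - y) + b)"
      using that by (simp only: open_segment_translation_eq)
    then show ?thesis by simp
  qed
  obtain s where s: "\<forall>i\<in>?S. s i \<in> \<phi> i" "\<nu> = sum s ?S"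
    using \<nu> M by (auto simp: vertices_def extreme_point_of_def)
  have sv: "s k \<in> vertices (\<phi> k)" if k: "k \<in> ?S" for k
    using s(1) k ext[OF swap[OF s k] swap[OF s k]] shift[of "s k" _ _ \<nu>]
    unfolding vertices_def extreme_point_of_def by blast
  show ?thesis
  proof (rule ex1I)
    show "restrict s ?S \<in> (\<Pi>\<^sub>E i\<in>?S. vertices (\<phi> i)) \<and> \<nu> = sum (restrict s ?S) ?S"
      using sv s(2) by auto
  next
    fix g assume g: "g \<in> (\<Pi>\<^sub>E i\<in>?S. vertices (\<phi> i)) \<and> \<nu> = sum g ?S"
    then have gm: "\<forall>i\<in>?S. g i \<in> \<phi> i" and gs: "\<nu> = sum g ?S"
      by (auto simp: vertices_def extreme_point_of_def dest!: PiE_mem)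
    have "g k = s k" if k: "k \<in> ?S" for k
    proof (rule ccontr)
      assume ne: "g k \<noteq> s k"
      let ?a = "\<nu> - s k + g k" and ?b = "\<nu> - g k + s k"
      have "?a \<in> coeff_sum \<phi>" "?b \<in> coeff_sum \<phi>"
        using swap[OF s k] swap[OF gm gs k] gm s k by auto
      moreover have "\<nu> = midpoint ?a ?b"
        by (simp add: midpoint_def flip: scaleR_2)
      moreover have "?a \<noteq> ?b"
      proof
        assume "?a = ?b"
        then have "2 *\<^sub>R g k = 2 *\<^sub>R s k" by (simp add: scaleR_2 algebra_simps)
        with ne show False by simp
      qed
      ultimately show False
        using ext[of ?a ?b] midpoint_in_open_segment[of ?a ?b] by metis
    qed
    then show "g = restrict s ?S"
      using g by (auto simp: fun_eq_iff restrict_def dest: PiE_arb)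
  qed
qed

definition rho :: "(nat \<Rightarrow> (real^'n) set) \<Rightarrow> real^'n \<Rightarrow> nat \<Rightarrow> nat \<Rightarrow> real^'n" where
  "rho \<phi> \<nu> i j =
     - ((1 / (real i - real j)) *\<^sub>R (vertex_decomp \<phi> \<nu> i - vertex_decomp \<phi> \<nu> j))"

definition generic :: "(nat \<Rightarrow> (real^'n) set) \<Rightarrow> bool" where
  "generic \<phi> \<longleftrightarrow>
     (\<forall>\<nu>\<in>vertices (coeff_sum \<phi>).
        \<forall>i\<in>Supp \<phi>. \<forall>j\<in>Supp \<phi>. \<forall>i'\<in>Supp \<phi>. \<forall>j'\<in>Supp \<phi>.
          i \<noteq> j \<longrightarrow> i' \<noteq> j' \<longrightarrow> rho \<phi> \<nu> i j = rho \<phi> \<nu> i' j' \<longrightarrow> {i, j} = {i', j'})"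


section \<open>Solutions\<close>

text \<open>\<open>\<Sum>k<i. P\<close> is the \<open>i\<close>-fold Minkowski sum of \<open>P\<close>, equal to \<open>{0}\<close> for \<open>i = 0\<close>.\<close>

definition summand :: "(nat \<Rightarrow> (real^'n) set) \<Rightarrow> (real^'n) set \<Rightarrow> nat \<Rightarrow> (real^'n) set" where
  "summand \<phi> P i = \<phi> i + (\<Sum>k<i. P)"

definition evaluation :: "(nat \<Rightarrow> (real^'n) set) \<Rightarrow> (real^'n) set \<Rightarrow> (real^'n) set" where
  "evaluation \<phi> P = closed_convex_hull (\<Union>i\<in>Supp \<phi>. summand \<phi> P i)"

definition is_solution :: "(nat \<Rightarrow> (real^'n) set) \<Rightarrow> (real^'n) set \<Rightarrow> bool" where
  "is_solution \<phi> P \<longleftrightarrow>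
     polyhedron P \<and> vertices P \<noteq> {} \<and>
     (\<forall>w\<in>vertices (evaluation \<phi> P).
        \<exists>i\<in>Supp \<phi>. \<exists>j\<in>Supp \<phi>. i \<noteq> j \<and>
          w \<in> vertices (summand \<phi> P i) \<and> w \<in> vertices (summand \<phi> P j))"

definition local_solution ::
    "(nat \<Rightarrow> (real^'n) set) \<Rightarrow> real^'n \<Rightarrow> (real^'n) set \<Rightarrow> bool" where
  "local_solution \<phi> v P \<longleftrightarrow>
     is_solution \<phi> P \<and> normal_support P \<subseteq> inner_normal_cone (coeff_sum \<phi>) v"

definition MW_minimal_local_solution ::
    "(nat \<Rightarrow> (real^'n) set) \<Rightarrow> real^'n \<Rightarrow> (real^'n) set \<Rightarrow> bool" where
  "MW_minimal_local_solution \<phi> v P \<longleftrightarrow>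
     local_solution \<phi> v P \<and>
     (\<forall>P'. local_solution \<phi> v P' \<and> vertices P' = vertices P \<and>
           recession_cone P' \<subseteq> recession_cone P \<longrightarrow>
           recession_cone P' = recession_cone P)"


section \<open>The fan at a vertex of the coefficient sum\<close>

definition hyperplane1 ::
    "(nat \<Rightarrow> (real^'n) set) \<Rightarrow> real^'n \<Rightarrow> nat \<Rightarrow> nat \<Rightarrow> nat \<Rightarrow> (real^'n) set" where
  "hyperplane1 \<phi> v i j k =
     {\<mu>. \<mu> \<bullet> (vertex_decomp \<phi> v k + real k *\<^sub>R rho \<phi> v i j) =
         \<mu> \<bullet> (vertex_decomp \<phi> v i + real i *\<^sub>R rho \<phi> v i j)}"

definition hyperplane2 ::
    "(nat \<Rightarrow> (real^'n) set) \<Rightarrow> real^'n \<Rightarrow> nat \<Rightarrow> nat \<Rightarrow> nat \<Rightarrow> nat \<Rightarrow> (real^'n) set" where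
  "hyperplane2 \<phi> v i j i' j' = {\<mu>. \<mu> \<bullet> rho \<phi> v i j = \<mu> \<bullet> rho \<phi> v i' j'}"

definition arrangement :: "(nat \<Rightarrow> (real^'n) set) \<Rightarrow> real^'n \<Rightarrow> (real^'n) set set" where
  "arrangement \<phi> v =
     ({hyperplane1 \<phi> v i j k | i j k.
         i \<in> Supp \<phi> \<and> j \<in> Supp \<phi> \<and> k \<in> Supp \<phi> \<and> i \<noteq> j} \<union>
      {hyperplane2 \<phi> v i j i' j' | i j i' j'.
         i \<in> Supp \<phi> \<and> j \<in> Supp \<phi> \<and> i' \<in> Supp \<phi> \<and> j' \<in> Supp \<phi> \<and> i \<noteq> j \<and> i' \<noteq> j'})
     - {UNIV}"

text \<open>
  The maximal cones of the fan of a central arrangement are the closures of its regions,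
  i.e. of the connected components of its complement.
\<close>

definition maximal_cones :: "(nat \<Rightarrow> (real^'n) set) \<Rightarrow> real^'n \<Rightarrow> (real^'n) set set" where
  "maximal_cones \<phi> v =
     {closure R \<inter> inner_normal_cone (coeff_sum \<phi>) v | R.
        R \<in> components (- \<Union>(arrangement \<phi> v)) \<and>
        full_dimensional (closure R \<inter> inner_normal_cone (coeff_sum \<phi>) v)}"

definition primary_label ::
    "(nat \<Rightarrow> (real^'n) set) \<Rightarrow> real^'n \<Rightarrow> (real^'n) set \<Rightarrow> nat \<times> nat \<Rightarrow> bool" where
  "primary_label \<phi> v C = (\<lambda>(i, j).
     \<forall>k\<in>Supp \<phi>. \<forall>\<mu>\<in>C.
       \<mu> \<bullet> (vertex_decomp \<phi> v i + real i *\<^sub>R rho \<phi> v i j)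
       \<le> \<mu> \<bullet> (vertex_decomp \<phi> v k + real k *\<^sub>R rho \<phi> v i j))"

definition secondary_label ::
    "(nat \<Rightarrow> (real^'n) set) \<Rightarrow> real^'n \<Rightarrow> (real^'n) set \<Rightarrow> nat \<times> nat \<Rightarrow> nat \<times> nat \<Rightarrow> bool" where
  "secondary_label \<phi> v C = (\<lambda>(i, j) (i', j').
     \<forall>\<mu>\<in>C. \<mu> \<bullet> rho \<phi> v i j \<le> \<mu> \<bullet> rho \<phi> v i' j')"


section \<open>Local compatible systems\<close>

text \<open>
  A system is given by its size \<open>t\<close> and by the values of \<open>C\<close> and \<open>I\<close> on the indices
  \<open>{1..t}\<close>.  The cones \<open>C 1, \<dots>, C t\<close> are distinct.
\<close>

definition rho_pair :: "(nat \<Rightarrow> (real^'n) set) \<Rightarrow> real^'n \<Rightarrow> nat \<times> nat \<Rightarrow> real^'n" where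
  "rho_pair \<phi> v = (\<lambda>(i, j). rho \<phi> v i j)"

definition LCS_roots ::
    "(nat \<Rightarrow> (real^'n) set) \<Rightarrow> real^'n \<Rightarrow> nat \<Rightarrow> (nat \<Rightarrow> nat \<times> nat) \<Rightarrow> (real^'n) set" where
  "LCS_roots \<phi> v t I = {rho_pair \<phi> v (I k) | k. k \<in> {1..t}}"

definition LCS_cone ::
    "(nat \<Rightarrow> (real^'n) set) \<Rightarrow> real^'n \<Rightarrow> nat \<Rightarrow> (nat \<Rightarrow> (real^'n) set) \<Rightarrow>
     (nat \<Rightarrow> nat \<times> nat) \<Rightarrow> real^'n \<Rightarrow> (real^'n) set" where
  "LCS_cone \<phi> v t C I \<gamma> = \<Union>{C k | k. k \<in> {1..t} \<and> rho_pair \<phi> v (I k) = \<gamma>}"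

definition LCS_support :: "nat \<Rightarrow> (nat \<Rightarrow> (real^'n) set) \<Rightarrow> (real^'n) set" where
  "LCS_support t C = (\<Union>k\<in>{1..t}. C k)"

definition local_compatible_system ::
    "(nat \<Rightarrow> (real^'n) set) \<Rightarrow> real^'n \<Rightarrow> nat \<Rightarrow> (nat \<Rightarrow> (real^'n) set) \<Rightarrow>
     (nat \<Rightarrow> nat \<times> nat) \<Rightarrow> bool" where
  "local_compatible_system \<phi> v t C I \<longleftrightarrow>
     1 \<le> t \<and>
     inj_on C {1..t} \<and>
     (\<forall>k\<in>{1..t}. C k \<in> maximal_cones \<phi> v) \<and>
     (\<forall>k\<in>{1..t}. fst (I k) \<in> Supp \<phi> \<and> snd (I k) \<in> Supp \<phi> \<and> fst (I k) \<noteq> snd (I k)) \<and>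
     (\<forall>\<gamma>\<in>LCS_roots \<phi> v t I. polyhedral_cone (LCS_cone \<phi> v t C I \<gamma>)) \<and>
     (\<forall>k\<in>{1..t}. primary_label \<phi> v (C k) (I k)) \<and>
     (\<forall>\<alpha>\<in>{1..t}. \<forall>\<beta>\<in>{1..t}. \<alpha> \<noteq> \<beta> \<longrightarrow> secondary_label \<phi> v (C \<alpha>) (I \<alpha>) (I \<beta>)) \<and>
     (\<forall>f. \<forall>l\<in>{1..t}. f facet_of C l \<and> (\<forall>k\<in>{1..t}. f facet_of C k \<longrightarrow> k = l) \<longrightarrow>
        (\<forall>D\<in>maximal_cones \<phi> v. D \<notin> C ` {1..t} \<and> f facet_of D \<longrightarrow>
           \<not> primary_label \<phi> v D (I l) \<or>
           (\<exists>\<beta>\<in>{1..t}. \<not> secondary_label \<phi> v D (I l) (I \<beta>))))"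

definition restricted_roots ::
    "(nat \<Rightarrow> (real^'n) set) \<Rightarrow> real^'n \<Rightarrow> nat \<Rightarrow> (nat \<Rightarrow> (real^'n) set) \<Rightarrow>
     (nat \<Rightarrow> nat \<times> nat) \<Rightarrow> (real^'n) set \<Rightarrow> (real^'n) set" where
  "restricted_roots \<phi> v t C I L =
     {\<gamma> \<in> LCS_roots \<phi> v t I. full_dimensional (LCS_cone \<phi> v t C I \<gamma> \<inter> L)}"

text \<open>
  \<open>P\<close> is the associated polyhedron of the restriction to \<open>L\<close>.  The conditions determine \<open>P\<close>
  whenever \<open>restricted_roots\<close> is nonempty.  A maximal \<open>L\<close> can be of lower dimension, with no
  restricted roots: the condition then only says that \<open>P\<close> has no vertex.
\<close>

definition associated_polyhedron ::
    "(nat \<Rightarrow> (real^'n) set) \<Rightarrow> real^'n \<Rightarrow> nat \<Rightarrow> (nat \<Rightarrow> (real^'n) set) \<Rightarrow>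
     (nat \<Rightarrow> nat \<times> nat) \<Rightarrow> (real^'n) set \<Rightarrow> (real^'n) set \<Rightarrow> bool" where
  "associated_polyhedron \<phi> v t C I L P \<longleftrightarrow>
     polyhedron P \<and>
     vertices P = restricted_roots \<phi> v t C I L \<and>
     (\<forall>\<gamma>\<in>restricted_roots \<phi> v t C I L.
        inner_normal_cone P \<gamma> = LCS_cone \<phi> v t C I \<gamma> \<inter> L)"

definition maximal_convex_subcone :: "(real^'n) set \<Rightarrow> (real^'n) set \<Rightarrow> bool" where
  "maximal_convex_subcone S L \<longleftrightarrow>
     polyhedral_cone L \<and> L \<subseteq> S \<and>
     (\<forall>L'. polyhedral_cone L' \<and> L \<subseteq> L' \<and> L' \<subseteq> S \<longrightarrow> L' = L)"

end

theory Submission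
  imports Defs
begin

text \<open>
  On \<open>N = N_M(v)\<close> every coefficient is minimised at \<open>v_i\<close>, so the evaluation at a \<open>v\<close>-local \<open>P\<close>
  is governed by the points \<open>v_i + i \<gamma>\<close>, with \<open>\<gamma>\<close> the vertex of \<open>P\<close> selected by the functional.
  Hence \<open>P\<close> is a solution iff for each vertex \<open>\<gamma>\<close> the normal cone \<open>N_P(\<gamma>)\<close> lies in the cone of
  functionals for which \<open>\<gamma>\<close> is a tropical root.  For a fixed vertex set \<open>V\<close>, let \<open>D_\<gamma>\<close> be the part
  of that cone on which \<open>\<gamma>\<close> is minimal among \<open>V\<close>; by genericity \<open>D_\<gamma>\<close> is a polyhedral cone bounded
  by hyperplanes of the arrangement.  Solutions with vertex set \<open>V\<close> then correspond, via
  \<open>P \<mapsto> N(P)\<close>, to polyhedral subcones of the union of the \<open>D_\<gamma>\<close> that meet every \<open>D_\<gamma>\<close> in full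
  dimension, and small recession cones to large \<open>N(P)\<close>.  On the other side, conditions (1)-(4) say
  exactly that the cones \<open>C_\<gamma>\<close> of a local compatible system are the \<open>D_\<gamma>\<close>: two cones of the fan in the
  convex set \<open>D_\<gamma>\<close> are joined by a path through facets, so by (4) no cone of \<open>D_\<gamma>\<close> is omitted.
\<close>

section \<open>Recession cones and normal fans of polyhedra\<close>

text \<open>Being a solution constrains only the vertices of the evaluation, so it speaks directly
  only about functionals with a unique minimising point there. These are dense in each normal cone,
  and closedness of the root cones carries the conclusion over to the rest. Recession cones are
  compared by duality: N(P) is the dual of the recession cone, which reverses inclusions and loses
  nothing because recession cones of polyhedra are closed and convex. This rests on the
  decomposition of a polyhedron with a vertex into the hull of its vertices plus its recession cone.
  Genericity enters through convexity: if \<gamma> were the root of several pairs, its root cone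
  would be a union of cones, one for each pair. The path through facets meets the obstacle that a
  segment between two chambers may pass through the intersection of several hyperplanes, away from
  every facet; this is cured by perturbing an endpoint, except for parallel normals, which describe
  the same hyperplane. Finally, a maximal convex subcone may lose some of the roots; requiring V to
  consist of all of them forces it to meet every D_\<gamma> in full dimension.\<close>

definition dual_cone :: "(real^'n) set \<Rightarrow> (real^'n) set" where
  "dual_cone S = {l. \<forall>d\<in>S. 0 \<le> l \<bullet> d}"

lemma dual_cone_antimono: "S \<subseteq> T \<Longrightarrow> dual_cone T \<subseteq> dual_cone S"
  by (auto simp: dual_cone_def)

lemma nonneg_if_bounded_below_on_ray:
  fixes a b :: real
  assumes "\<And>t. 0 \<le> t \<Longrightarrow> b \<le> c + t * a"
  shows "0 \<le> a"
proof (rule ccontr)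
  assume "\<not> 0 \<le> a"
  then have a: "a < 0" by simp
  \<comment> \<open>Chosen so that t * a = - (|c - b| + 1), which pushes c + t * a below b.\<close>
  define t where "t = (\<bar>c - b\<bar> + 1) / (- a)"
  have "0 \<le> t" using a by (simp add: t_def divide_nonneg_neg)
  moreover have "t * a = - (\<bar>c - b\<bar> + 1)" using a by (simp add: t_def)
  ultimately show False using assms[of t] by linarith
qed

text \<open>Bipolar theorem. A point outside K is strictly separated from K. As K contains 0, the
  separating level is negative; as K is closed under scaling, the separating functional is
  nonnegative on K and so lies in the dual.\<close>

lemma dual_cone_dual_cone:
  assumes "closed K" "convex_cone K"
  shows "dual_cone (dual_cone K) = K"
proof
  show "K \<subseteq> dual_cone (dual_cone K)"
    by (auto simp: dual_cone_def inner_commute)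
  show "dual_cone (dual_cone K) \<subseteq> K"
  proof
    fix z assume z: "z \<in> dual_cone (dual_cone K)"
    show "z \<in> K"
    proof (rule ccontr)
      assume "z \<notin> K"
      then obtain a b where ab: "a \<bullet> z < b" "\<And>x. x \<in> K \<Longrightarrow> b < a \<bullet> x"
        using separating_hyperplane_closed_point[of K z] assms by (auto simp: convex_cone_def)
      have "a \<bullet> 0 > b" using ab(2) assms(2) convex_cone_contains_0 by blast
      then have "b < 0" by simp
      have "0 \<le> a \<bullet> x" if "x \<in> K" for x
      proof (rule nonneg_if_bounded_below_on_ray[where b = b and c = 0])
        fix t :: real assume "0 \<le> t"
        then show "b \<le> 0 + t * (a \<bullet> x)"
          using ab(2)[of "t *\<^sub>R x"] convex_cone_scaleR[OF assms(2) _ that] by fastforce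
      qed
      then have "a \<in> dual_cone K" by (simp add: dual_cone_def)
      then have "0 \<le> z \<bullet> a" using z by (simp add: dual_cone_def)
      with ab(1) \<open>b < 0\<close> show False by (simp add: inner_commute)
    qed
  qed
qed

lemma convex_cone_dual_cone: "convex_cone (dual_cone S)"
  by (auto simp: convex_cone_iff dual_cone_def inner_add_left)

lemma closed_dual_cone: "closed (dual_cone S)"
proof -
  have "dual_cone S = (\<Inter>d\<in>S. {l. d \<bullet> l \<ge> 0})"
    by (auto simp: dual_cone_def inner_commute)
  then show ?thesis by (simp add: closed_INT closed_halfspace_ge)
qed

lemma dual_cone_convex_cone_hull: "dual_cone (convex_cone hull S) = dual_cone S"
proof
  show "dual_cone (convex_cone hull S) \<subseteq> dual_cone S"
    by (intro dual_cone_antimono hull_subset)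
  show "dual_cone S \<subseteq> dual_cone (convex_cone hull S)"
  proof
    fix l assume "l \<in> dual_cone S"
    then have "S \<subseteq> {x. l \<bullet> x \<ge> 0}" by (auto simp: dual_cone_def)
    then have "convex_cone hull S \<subseteq> {x. l \<bullet> x \<ge> 0}"
      by (rule hull_minimal) (rule convex_cone_halfspace_ge)
    then show "l \<in> dual_cone (convex_cone hull S)" by (auto simp: dual_cone_def)
  qed
qed

lemma dual_cone_dual_cone_finite:
  assumes "finite S"
  shows "dual_cone (dual_cone S) = convex_cone hull S"
  using dual_cone_dual_cone[OF closed_convex_cone_hull[OF assms] convex_cone_convex_cone_hull]
  by (simp add: dual_cone_convex_cone_hull)

section \<open>Recession cones of polyhedra\<close>

lemma polyhedron_explicit:
  fixes P :: "(real^'n) set"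
  assumes "polyhedron P"
  obtains F where "finite F" "P = {x. \<forall>(a, b)\<in>F. a \<bullet> x \<le> b}"
proof -
  obtain F where F: "finite F" "P = \<Inter>F" "\<forall>h\<in>F. \<exists>a b. a \<noteq> 0 \<and> h = {x. a \<bullet> x \<le> b}"
    using assms unfolding polyhedron_def by metis
  obtain a b where ab: "\<And>h. h \<in> F \<Longrightarrow> h = {x. a h \<bullet> x \<le> b h}"
    using F(3) by metis
  show thesis
  proof
    show "finite ((\<lambda>h. (a h, b h)) ` F)" using F(1) by simp
    show "P = {x. \<forall>(a, b)\<in>(\<lambda>h. (a h, b h)) ` F. a \<bullet> x \<le> b}"
      unfolding F(2) using ab by auto
  qed
qed

text \<open>In a closed convex set a single ray decides whether a direction is recessive: x + t d is
  the limit of points on the segments from x to ever more distant points of the ray from z.\<close>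

lemma recession_coneI:
  fixes P :: "(real^'n) set"
  assumes "closed P" "convex P" "z \<in> P" "\<And>t. 0 \<le> t \<Longrightarrow> z + t *\<^sub>R d \<in> P"
  shows "d \<in> recession_cone P"
  unfolding recession_cone_def
proof (intro CollectI ballI allI impI)
  fix x and t :: real assume x: "x \<in> P" and t: "0 \<le> t"
  \<comment> \<open>The weight 1/(k+1) cancels the parameter (k+1) t, so the contribution t d stays
    fixed while that of z vanishes in the limit.\<close>
  define f where "f k = (1 - inverse (real (Suc k))) *\<^sub>R x
    + inverse (real (Suc k)) *\<^sub>R (z + (real (Suc k) * t) *\<^sub>R d)" for k
  have "f k \<in> P" for k
    unfolding f_def by (rule convexD[OF assms(2) x assms(4)]) (use t in \<open>auto simp: field_simps\<close>)
  moreover have "f \<longlonglongrightarrow> x + t *\<^sub>R d"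
  proof -
    have f: "f = (\<lambda>k. (1 - inverse (real (Suc k))) *\<^sub>R x + inverse (real (Suc k)) *\<^sub>R z + t *\<^sub>R d)"
      by (rule ext) (simp add: f_def scaleR_add_right del: of_nat_Suc)
    have "f \<longlonglongrightarrow> (1 - 0) *\<^sub>R x + 0 *\<^sub>R z + t *\<^sub>R d"
      unfolding f by (intro tendsto_intros LIMSEQ_inverse_real_of_nat)
    then show ?thesis by simp
  qed
  ultimately show "x + t *\<^sub>R d \<in> P"
    using closed_sequentially[OF assms(1)] by blast
qed

lemma recession_coneD: "d \<in> recession_cone P \<Longrightarrow> x \<in> P \<Longrightarrow> 0 \<le> t \<Longrightarrow> x + t *\<^sub>R d \<in> P"
  by (auto simp: recession_cone_def)

lemma recession_coneD1: "d \<in> recession_cone P \<Longrightarrow> x \<in> P \<Longrightarrow> x + d \<in> P"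
  using recession_coneD[of d P x 1] by simp

lemma convex_cone_recession_cone: "convex_cone (recession_cone P)"
proof -
  have "x + t *\<^sub>R (a + b) \<in> P" if "a \<in> recession_cone P" "b \<in> recession_cone P" "x \<in> P" "0 \<le> t"
    for a b x t
    using recession_coneD[OF that(2) recession_coneD[OF that(1,3,4)] that(4)]
    by (simp add: scaleR_add_right add.assoc)
  then show ?thesis
    by (auto simp: convex_cone_iff recession_cone_def)
qed

lemma recession_cone_explicit:
  fixes P :: "(real^'n) set"
  assumes P: "P = {x. \<forall>(a, b)\<in>F. a \<bullet> x \<le> b}" and "P \<noteq> {}"
  shows "recession_cone P = dual_cone ((\<lambda>(a, b). - a) ` F)"
proof (intro subset_antisym subsetI)
  fix d assume d: "d \<in> recession_cone P"
  obtain x where x: "x \<in> P" using assms by auto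
  have "0 \<le> d \<bullet> - a" if "(a, b) \<in> F" for a b
  proof (rule nonneg_if_bounded_below_on_ray[where b = "-b" and c = "- (a \<bullet> x)"])
    fix t :: real assume "0 \<le> t"
    with d x have "x + t *\<^sub>R d \<in> P" by (auto simp: recession_cone_def)
    then have "a \<bullet> (x + t *\<^sub>R d) \<le> b" using that P by auto
    then show "- b \<le> - (a \<bullet> x) + t * (d \<bullet> - a)"
      by (simp add: inner_add_right inner_commute)
  qed
  then show "d \<in> dual_cone ((\<lambda>(a, b). - a) ` F)" by (auto simp: dual_cone_def)
next
  fix d assume "d \<in> dual_cone ((\<lambda>(a, b). - a) ` F)"
  then have d: "a \<bullet> d \<le> 0" if "(a, b) \<in> F" for a b
    using that by (force simp: dual_cone_def inner_commute)
  show "d \<in> recession_cone P"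
    unfolding recession_cone_def
  proof (intro CollectI ballI allI impI)
    fix x and t :: real assume x: "x \<in> P" and t: "0 \<le> t"
    have "a \<bullet> (x + t *\<^sub>R d) \<le> b" if "(a, b) \<in> F" for a b
    proof -
      have "a \<bullet> x \<le> b" using x P that by auto
      moreover have "t * (a \<bullet> d) \<le> 0" using t d[OF that] by (simp add: mult_nonneg_nonpos)
      ultimately show ?thesis by (simp add: inner_add_right)
    qed
    then show "x + t *\<^sub>R d \<in> P" using P by auto
  qed
qed

text \<open>Finiteness matters because the convex cone hull of a finite set is closed and
  polyhedral, which is how duals of recession cones become polyhedral cones.\<close>

lemma recession_cone_dual_finite:
  fixes P :: "(real^'n) set"
  assumes "polyhedron P" "P \<noteq> {}"
  obtains G where "finite G" "recession_cone P = dual_cone G"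
proof -
  obtain F where "finite F" "P = {x. \<forall>(a, b)\<in>F. a \<bullet> x \<le> b}"
    using polyhedron_explicit[OF assms(1)] .
  with recession_cone_explicit[OF this(2) assms(2)] show thesis
    by (intro that[of "(\<lambda>(a, b). - a) ` F"]) auto
qed

lemma polyhedral_cone_dual_recession_cone:
  assumes "polyhedron P" "P \<noteq> {}"
  shows "polyhedral_cone (dual_cone (recession_cone P))"
proof -
  obtain G where "finite G" "recession_cone P = dual_cone G"
    using recession_cone_dual_finite[OF assms] .
  then show ?thesis
    using dual_cone_dual_cone_finite polyhedron_convex_cone_hull convex_cone_convex_cone_hull
    by (metis polyhedral_cone_def)
qed

lemma closed_recession_cone:
  assumes "polyhedron P" "P \<noteq> {}"
  shows "closed (recession_cone P)"
  using recession_cone_dual_finite[OF assms] closed_dual_cone by metis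

lemma dual_cone_dual_recession_cone:
  assumes "polyhedron P" "P \<noteq> {}"
  shows "dual_cone (dual_cone (recession_cone P)) = recession_cone P"
  using dual_cone_dual_cone closed_recession_cone[OF assms] convex_cone_recession_cone by blast

lemma recession_cone_convex_cone:
  assumes "convex_cone K" "closed K"
  shows "recession_cone K = K"
proof (intro subset_antisym subsetI)
  fix d assume "d \<in> recession_cone K"
  then show "d \<in> K"
    using recession_coneD1[of d K 0] assms convex_cone_contains_0 by force
next
  fix d assume "d \<in> K"
  then show "d \<in> recession_cone K"
    using assms by (auto simp: recession_cone_def intro!: convex_cone_add convex_cone_scaleR)
qed

text \<open>A closed convex cone is its own recession cone, so K is the dual of a finite set G. Its
  dual is then the hull of G, again a polyhedron, hence the dual of a finite set H; dualising once
  more exhibits K as the hull of H.\<close>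

lemma polyhedral_cone_finitely_generated:
  assumes "polyhedral_cone K"
  obtains G where "finite G" "K = convex_cone hull G"
proof -
  have K: "polyhedron K" "convex_cone K" "closed K" "K \<noteq> {}"
    using assms polyhedron_imp_closed by (auto simp: polyhedral_cone_def convex_cone_def)
  obtain G where G: "finite G" "K = dual_cone G"
    using recession_cone_dual_finite[OF K(1,4)] recession_cone_convex_cone[OF K(2,3)] by metis
  have "polyhedron (dual_cone K)" "dual_cone K \<noteq> {}"
    using G dual_cone_dual_cone_finite polyhedron_convex_cone_hull convex_cone_hull_nonempty by metis+
  then obtain H where "finite H" "dual_cone K = dual_cone H"
    using recession_cone_dual_finite recession_cone_convex_cone[OF convex_cone_dual_cone closed_dual_cone]
    by metis
  then show thesis
    using that dual_cone_dual_cone[OF K(3,2)] dual_cone_dual_cone_finite by metis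
qed

section \<open>Pointed recession cones and the Minkowski-Weyl decomposition\<close>

definition pointed :: "(real^'n) set \<Rightarrow> bool" where
  "pointed R \<longleftrightarrow> (\<forall>d\<in>R. - d \<in> R \<longrightarrow> d = 0)"

lemma pointed_recession_cone:
  assumes "vertices P \<noteq> {}"
  shows "pointed (recession_cone P)"
  unfolding pointed_def
proof (intro ballI impI)
  fix d assume d: "d \<in> recession_cone P" "- d \<in> recession_cone P"
  obtain w where w: "w \<in> P" "\<And>a b. a \<in> P \<Longrightarrow> b \<in> P \<Longrightarrow> w \<notin> open_segment a b"
    using assms by (auto simp: vertices_def extreme_point_of_def)
  have "w + d \<in> P" "w + - d \<in> P" using d w recession_coneD1 by blast+
  then have "w \<notin> open_segment (w + d) (w + - d)" using w by blast
  moreover have "w = midpoint (w + d) (w + - d)" by (simp add: midpoint_def flip: scaleR_2)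
  ultimately have "w + d = w + - d" using midpoint_in_open_segment by metis
  then have "2 *\<^sub>R d = 0" by (simp add: scaleR_2 eq_neg_iff_add_eq_0)
  then show "d = 0" by simp
qed

lemma convex_sum_cone:
  fixes S R :: "(real^'n) set"
  assumes "convex S" "convex R"
  shows "convex {x + r | x r. x \<in> S \<and> r \<in> R}"
proof -
  have "{x + r | x r. x \<in> S \<and> r \<in> R} = (\<Union>x\<in>S. \<Union>y\<in>R. {x + y})" by auto
  then show ?thesis using convex_sums[OF assms] by simp
qed

text \<open>Follows the line through x and y until it leaves P. Both orientations of e are allowed
  because the decomposition theorem leaves x in each direction that is not recessive.\<close>

lemma exit_point:
  fixes P :: "(real^'n) set"
  assumes P: "closed P" "convex P" and x: "x \<in> P" and y: "y \<in> P"
    and e: "e = x - y \<or> e = y - x" "e \<noteq> 0" "e \<notin> recession_cone P"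
  obtains t where "0 \<le> t" "x + t *\<^sub>R e \<in> P" "x + t *\<^sub>R e \<notin> rel_interior P"
proof -
  define T where "T = {t. 0 \<le> t \<and> x + t *\<^sub>R e \<in> P}"
  have T0: "0 \<in> T" using x by (simp add: T_def)
  have conv: "s \<in> T" if "t \<in> T" "0 \<le> s" "s \<le> t" for s t
  proof (cases "t = 0")
    case False
    with that have t: "t > 0" by (auto simp: T_def)
    have "(1 - s / t) *\<^sub>R x + (s / t) *\<^sub>R (x + t *\<^sub>R e) \<in> P"
      by (rule convexD[OF P(2) x]) (use that t in \<open>auto simp: T_def\<close>)
    moreover have "(1 - s / t) *\<^sub>R x + (s / t) *\<^sub>R (x + t *\<^sub>R e) = x + s *\<^sub>R e"
      using t by (simp add: algebra_simps)
    ultimately show ?thesis using that by (simp add: T_def)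
  qed (use that in auto)
  have "\<exists>t\<ge>0. x + t *\<^sub>R e \<notin> P"
    using recession_coneI[OF P x, of e] e(3) by blast
  then obtain b where b: "b \<ge> 0" "b \<notin> T" by (auto simp: T_def)
  have bdd: "bdd_above T"
    using conv b by (intro bdd_aboveI[of _ b]) (meson linear)
  have clT: "closed T"
  proof -
    have "T = {0..} \<inter> (\<lambda>t. x + t *\<^sub>R e) -` P" by (auto simp: T_def)
    moreover have "closed ((\<lambda>t. x + t *\<^sub>R e) -` P)"
      by (rule closed_vimage[OF P(1)]) (intro continuous_intros)
    ultimately show ?thesis by auto
  qed
  define t where "t = Sup T"
  have tT: "t \<in> T" unfolding t_def using closed_contains_Sup T0 bdd clT by blast
  have max: "s \<le> t" if "s \<in> T" for s unfolding t_def using that bdd by (rule cSup_upper)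
  have "x + t *\<^sub>R e \<notin> rel_interior P"
  proof
    assume z: "x + t *\<^sub>R e \<in> rel_interior P"
    \<comment> \<open>A point of P strictly behind the exit point. If the exit point were relatively
      interior, the segment from y' could be prolonged beyond it inside P, against maximality of
      t.\<close>
    obtain y' s where y': "y' \<in> P" "s > 0" "x + t *\<^sub>R e = y' + s *\<^sub>R e"
    proof (cases "e = x - y")
      case True
      then show thesis using tT y by (intro that[of y "t + 1"]) (auto simp: T_def algebra_simps)
    next
      case False
      then have "e = y - x" using e by auto
      then have "1 \<in> T" using y by (auto simp: T_def)
      then show thesis using max x by (intro that[of x t]) force+
    qed
    have "P \<noteq> {}" using x by auto
    then obtain u where u: "u > 1" "(1 - u) *\<^sub>R y' + u *\<^sub>R (x + t *\<^sub>R e) \<in> P"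
      using z y'(1) P(2) convex_rel_interior_iff by blast
    have "(1 - u) *\<^sub>R y' + u *\<^sub>R (x + t *\<^sub>R e) = (x + t *\<^sub>R e) + (u - 1) *\<^sub>R (x + t *\<^sub>R e - y')"
      by (simp add: algebra_simps)
    also have "x + t *\<^sub>R e - y' = s *\<^sub>R e" using y'(3) by simp
    also have "x + t *\<^sub>R e + (u - 1) *\<^sub>R (s *\<^sub>R e) = x + (t + (u - 1) * s) *\<^sub>R e"
      by (simp add: algebra_simps)
    finally have "t + (u - 1) * s \<in> T" using u y' tT by (auto simp: T_def)
    moreover have "(u - 1) * s > 0" using u(1) y'(2) by simp
    ultimately show False using max[of "t + (u - 1) * s"] by linarith
  qed
  then show thesis using that tT by (auto simp: T_def)
qed

text \<open>Every point lies on a segment or a ray with endpoints in proper faces, so the decomposition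
  follows by induction on the dimension.\<close>

lemma Minkowski_Weyl:
  fixes P :: "(real^'n) set"
  assumes "polyhedron P" "pointed (recession_cone P)"
  shows "P \<subseteq> {c + r | c r. c \<in> convex hull (vertices P) \<and> r \<in> recession_cone P}"
  using assms
proof (induction "nat (aff_dim P + 1)" arbitrary: P rule: less_induct)
  case less
  let ?H = "{c + r | c r. c \<in> convex hull (vertices P) \<and> r \<in> recession_cone P}"
  have P: "closed P" "convex P"
    using less.prems polyhedron_imp_closed polyhedron_imp_convex by auto
  have convH: "convex ?H"
    using convex_cone_recession_cone[of P] by (intro convex_sum_cone) (auto simp: convex_cone_def)
  have bd: "z \<in> ?H" if z: "z \<in> P" "z \<notin> rel_interior P" for z
  proof -
    obtain F where F: "F facet_of P" "z \<in> F"
      using z rel_boundary_of_polyhedron[OF less.prems(1)] by auto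
    then have Ff: "F face_of P" "F \<subseteq> P" "polyhedron F"
      using facet_of_imp_face_of facet_of_imp_subset face_of_polyhedron_polyhedron less.prems by blast+
    have "nat (aff_dim F + 1) < nat (aff_dim P + 1)"
      using F aff_dim_geq[of F] by (auto simp: facet_of_def)
    moreover have rec: "recession_cone F \<subseteq> recession_cone P"
      using F Ff recession_coneI[OF P, of z] recession_coneD by blast
    then have "pointed (recession_cone F)"
      using less.prems by (auto simp: pointed_def)
    ultimately have "F \<subseteq> {c + r | c r. c \<in> convex hull (vertices F) \<and> r \<in> recession_cone F}"
      using less.hyps Ff by blast
    moreover have "vertices F \<subseteq> vertices P"
      using extreme_point_of_face[OF Ff(1)] by (auto simp: vertices_def)
    ultimately show ?thesis using rec hull_mono F by blast
  qed
  show ?case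
  proof
    fix x assume x: "x \<in> P"
    show "x \<in> ?H"
    proof (cases "P = {x}")
      case True
      then have "x \<in> vertices P" by (simp add: vertices_def)
      then have "x \<in> convex hull (vertices P)" by (rule hull_inc)
      moreover have "0 \<in> recession_cone P"
        using convex_cone_recession_cone convex_cone_contains_0 by blast
      ultimately show ?thesis by force
    next
      case False
      then obtain y where y: "y \<in> P" "y \<noteq> x" using x by blast
      \<comment> \<open>Pointedness forbids a full line, so at least one orientation leaves P; the
        other one either leaves as well or is recessive.\<close>
      have "x - y \<notin> recession_cone P \<or> y - x \<notin> recession_cone P"
        using less.prems(2) y by (auto simp: pointed_def)
      then obtain e where e: "e = x - y \<or> e = y - x" "e \<noteq> 0" "e \<notin> recession_cone P"
        using y by force
      obtain t where t: "0 \<le> t" "x + t *\<^sub>R e \<in> P" "x + t *\<^sub>R e \<notin> rel_interior P"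
        using exit_point[OF P x y(1) e] .
      then have z: "x + t *\<^sub>R e \<in> ?H" using bd by blast
      show ?thesis
      proof (cases "- e \<in> recession_cone P")
        case True
        obtain c r where cr: "c \<in> convex hull (vertices P)" "r \<in> recession_cone P"
          "x + t *\<^sub>R e = c + r" using z by auto
        have "x = c + (r + t *\<^sub>R (- e))" using cr(3) by (simp add: algebra_simps)
        moreover have "r + t *\<^sub>R (- e) \<in> recession_cone P"
          using convex_cone_recession_cone convex_cone_add convex_cone_scaleR True cr(2) t(1) by blast
        ultimately show ?thesis using cr(1) by blast
      next
        case False
        have e': "- e = x - y \<or> - e = y - x" "- e \<noteq> 0" using e by auto
        obtain s where s: "0 \<le> s" "x + s *\<^sub>R (- e) \<in> P" "x + s *\<^sub>R (- e) \<notin> rel_interior P"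
          using exit_point[OF P x y(1) e' False] .
        then have z': "x + s *\<^sub>R (- e) \<in> ?H" using bd by blast
        show ?thesis
        proof (cases "s + t = 0")
          case True
          then have "t = 0" using s t by linarith
          then show ?thesis using z by simp
        next
          case False
          then have st: "s + t > 0" using s(1) t(1) by linarith
          \<comment> \<open>With these weights the displacements t e and - s e cancel, so the
            combination of the two exit points is x.\<close>
          have "(s / (s + t)) *\<^sub>R (x + t *\<^sub>R e) + (t / (s + t)) *\<^sub>R (x + s *\<^sub>R (- e)) \<in> ?H"
            by (rule convexD[OF convH z z']) (use st s t in \<open>auto simp flip: add_divide_distrib\<close>)
          moreover have "(s / (s + t)) *\<^sub>R (x + t *\<^sub>R e) + (t / (s + t)) *\<^sub>R (x + s *\<^sub>R (- e)) 
              = (s / (s + t) + t / (s + t)) *\<^sub>R x"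
            by (simp add: algebra_simps)
          moreover have "s / (s + t) + t / (s + t) = 1"
            using st by (simp flip: add_divide_distrib)
          ultimately show ?thesis by simp
        qed
      qed
    qed
  qed
qed

section \<open>Exposed vertices and inner normal cones\<close>

lemma finite_vertices: "polyhedron P \<Longrightarrow> finite (vertices P)"
  by (simp add: vertices_def finite_polyhedron_extreme_points)

lemma vertices_subset: "vertices P \<subseteq> P"
  by (auto simp: vertices_def extreme_point_of_def)

lemma closed_hull_plus_cone:
  fixes G R :: "(real^'n) set"
  assumes "finite G" "closed R"
  shows "closed {c + r | c r. c \<in> convex hull G \<and> r \<in> R}"
proof -
  have "{c + r | c r. c \<in> convex hull G \<and> r \<in> R} = (\<Union>x\<in>convex hull G. \<Union>y\<in>R. {x + y})" by auto
  moreover have "compact (convex hull G)"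
    using assms by (intro compact_convex_hull finite_imp_compact) auto
  ultimately show ?thesis using compact_closed_sums[OF _ assms(2)] by simp
qed

text \<open>An extreme point has no recession part and does not lie in the hull of the other
  generators plus R. Separating it strictly from that closed convex set gives l; being bounded below
  along the rays of R, l is in the dual cone.\<close>

lemma extreme_point_strictly_exposed:
  fixes G R :: "(real^'n) set"
  assumes G: "finite G" and R: "closed R" "convex_cone R"
    and w: "w extreme_point_of {c + r | c r. c \<in> convex hull G \<and> r \<in> R}"
  obtains l where "w \<in> G" "l \<in> dual_cone R" "\<And>g. g \<in> G \<Longrightarrow> g \<noteq> w \<Longrightarrow> l \<bullet> w < l \<bullet> g"
proof -
  let ?S = "\<lambda>G. {c + r | c r. c \<in> convex hull G \<and> r \<in> R}"
  have R0: "0 \<in> R" using R convex_cone_contains_0 by blast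
  have in_hull: "w \<in> convex hull H" if "w \<in> ?S H" "H \<subseteq> G" for H
  proof -
    obtain c r where cr: "c \<in> convex hull H" "r \<in> R" "w = c + r" using \<open>w \<in> ?S H\<close> by auto
    have c: "c \<in> convex hull G" using cr hull_mono that by blast
    \<comment> \<open>The point w = c + r is the midpoint of c and c + 2 r, so extremality forces r
      = 0.\<close>
    have "c + 0 \<in> ?S G" "c + 2 *\<^sub>R r \<in> ?S G"
      using c cr R0 convex_cone_scaleR[OF R(2), of 2 r] by (blast, force)
    then have "w \<notin> open_segment (c + 0) (c + 2 *\<^sub>R r)"
      using w by (auto simp: extreme_point_of_def)
    moreover have "c + 0 + (c + 2 *\<^sub>R r) = 2 *\<^sub>R w"
      by (simp only: cr scaleR_2 add_0_right add_0_left ac_simps)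
    then have "w = midpoint (c + 0) (c + 2 *\<^sub>R r)"
      by (simp add: midpoint_def)
    ultimately have "c + 0 = c + 2 *\<^sub>R r" using midpoint_in_open_segment by metis
    then show ?thesis using cr by simp
  qed
  have hullS: "convex hull G \<subseteq> ?S G" using R0 by force
  have wS: "w \<in> ?S G" using w by (simp add: extreme_point_of_def)
  have wh: "w extreme_point_of (convex hull G)"
    using w in_hull[OF wS order_refl] hullS unfolding extreme_point_of_def by blast
  then have wG: "w \<in> G" by (rule extreme_point_of_convex_hull)
  let ?H = "G - {w}"
  have "w \<notin> convex hull ?H"
  proof
    assume "w \<in> convex hull ?H"
    then have "w extreme_point_of (convex hull ?H)"
      using wh hull_mono[of ?H G convex] unfolding extreme_point_of_def by blast
    then show False using extreme_point_of_convex_hull by blast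
  qed
  then have wH: "w \<notin> ?S ?H" using in_hull[of ?H] by blast
  have "closed (?S ?H)" using G R(1) by (simp add: closed_hull_plus_cone)
  moreover have "convex (?S ?H)"
    using R(2) by (intro convex_sum_cone) (auto simp: convex_cone_def)
  ultimately obtain l b where lb: "l \<bullet> w < b" "\<And>x. x \<in> ?S ?H \<Longrightarrow> b < l \<bullet> x"
    using separating_hyperplane_closed_point[OF _ _ wH] by blast
  show thesis
  \<comment> \<open>If w is the only generator, there is no ray to bound the separating functional
    on R, and 0 serves instead.\<close>
  proof (cases "?H = {}")
    case True
    show thesis by (rule that[of 0]) (use True wG in \<open>auto simp: dual_cone_def\<close>)
  next
    case False
    then obtain h where h: "h \<in> ?H" by blast
    show thesis
    proof (rule that[OF wG])
      have "0 \<le> l \<bullet> r" if "r \<in> R" for r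
      proof (rule nonneg_if_bounded_below_on_ray[where b = b and c = "l \<bullet> h"])
        fix t :: real assume "0 \<le> t"
        then have "h + t *\<^sub>R r \<in> ?S ?H"
          using hull_inc[OF h] convex_cone_scaleR[OF R(2) _ that] by blast
        then have "b < l \<bullet> (h + t *\<^sub>R r)" by (rule lb(2))
        then show "b \<le> l \<bullet> h + t * (l \<bullet> r)" by (simp add: inner_add_right)
      qed
      then show "l \<in> dual_cone R" by (simp add: dual_cone_def)
    next
      fix g assume "g \<in> G" "g \<noteq> w"
      then have "g \<in> convex hull ?H" by (simp add: hull_inc)
      then have "g + 0 \<in> ?S ?H" using R0 by blast
      then show "l \<bullet> w < l \<bullet> g" using lb by force
    qed
  qed
qed

text \<open>A convex set without interior lies in a hyperplane. For the dual cone, the normal of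
  that hyperplane and its negative both belong to the bidual R, which contradicts
  pointedness.\<close>

lemma interior_dual_cone_nonempty:
  fixes R :: "(real^'n) set"
  assumes "closed R" "convex_cone R" "pointed R"
  shows "interior (dual_cone R) \<noteq> {}"
proof
  assume e: "interior (dual_cone R) = {}"
  have conv: "convex (dual_cone R)" using convex_cone_dual_cone by (auto simp: convex_cone_def)
  obtain a b where ab: "a \<noteq> 0" "dual_cone R \<subseteq> {x. a \<bullet> x = b}"
    using empty_interior_subset_hyperplane[OF conv e] .
  have "0 \<in> dual_cone R" by (simp add: dual_cone_def)
  with ab have "b = 0" by auto
  with ab have "a \<in> dual_cone (dual_cone R)" "- a \<in> dual_cone (dual_cone R)"
    by (force simp: dual_cone_def)+
  then show False using assms ab by (auto simp: pointed_def dual_cone_dual_cone)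
qed

text \<open>A functional that is nonnegative on the recession cone attains its minimum at a vertex,
  by the decomposition into vertices and recession directions. So N(P) depends on the recession cone
  alone, and minimality can be read off from N(P).\<close>

lemma normal_support_eq:
  fixes P :: "(real^'n) set"
  assumes P: "polyhedron P" "vertices P \<noteq> {}"
  shows "normal_support P = dual_cone (recession_cone P)"
proof (intro subset_antisym subsetI)
  fix l assume "l \<in> normal_support P"
  then obtain g where g: "g \<in> vertices P" "\<And>x. x \<in> P \<Longrightarrow> l \<bullet> g \<le> l \<bullet> x"
    by (auto simp: normal_support_def inner_normal_cone_def)
  have "0 \<le> l \<bullet> d" if "d \<in> recession_cone P" for d
  proof -
    have "g + d \<in> P" using recession_coneD1[OF that] g vertices_subset by blast
    then show ?thesis using g(2)[of "g + d"] by (simp add: inner_add_right)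
  qed
  then show "l \<in> dual_cone (recession_cone P)" by (simp add: dual_cone_def)
next
  fix l assume l: "l \<in> dual_cone (recession_cone P)"
  obtain g where g: "g \<in> vertices P" "\<And>h. h \<in> vertices P \<Longrightarrow> l \<bullet> g \<le> l \<bullet> h"
    using finite_vertices[OF P(1)] P(2)
    by (metis (no_types, lifting) arg_min_if_finite(1) arg_min_least)
  have "l \<bullet> g \<le> l \<bullet> x" if x: "x \<in> P" for x
  proof -
    obtain c r where cr: "x = c + r" "c \<in> convex hull (vertices P)" "r \<in> recession_cone P"
      using subsetD[OF Minkowski_Weyl[OF P(1) pointed_recession_cone[OF P(2)]] x] by blast
    have "convex hull (vertices P) \<subseteq> {x. l \<bullet> x \<ge> l \<bullet> g}"
      by (rule hull_minimal) (use g convex_halfspace_ge in auto)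
    moreover have "0 \<le> l \<bullet> r" using l cr by (simp add: dual_cone_def)
    ultimately show ?thesis using cr by (fastforce simp: inner_add_right)
  qed
  then show "l \<in> normal_support P" using g by (auto simp: normal_support_def inner_normal_cone_def)
qed

lemma normal_support_cases:
  assumes "l \<in> normal_support P"
  obtains g where "g \<in> vertices P" "l \<in> inner_normal_cone P g"
  using assms by (auto simp: normal_support_def)

text \<open>Inside N(P) the minimum over P is already attained at some vertex, so comparison with
  the finitely many vertices suffices. Hence normal cones are cut out of N(P) by finitely many
  half-spaces.\<close>

lemma inner_normal_cone_vertex:
  assumes "g \<in> vertices P"
  shows "inner_normal_cone P g = {l \<in> normal_support P. \<forall>h\<in>vertices P. l \<bullet> g \<le> l \<bullet> h}"
proof (intro subset_antisym subsetI)
  fix l assume "l \<in> inner_normal_cone P g"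
  then show "l \<in> {l \<in> normal_support P. \<forall>h\<in>vertices P. l \<bullet> g \<le> l \<bullet> h}"
    using assms vertices_subset by (auto simp: inner_normal_cone_def normal_support_def)
next
  fix l assume l: "l \<in> {l \<in> normal_support P. \<forall>h\<in>vertices P. l \<bullet> g \<le> l \<bullet> h}"
  then obtain h where "h \<in> vertices P" "l \<in> inner_normal_cone P h"
    using normal_support_cases by blast
  with l show "l \<in> inner_normal_cone P g" by (fastforce simp: inner_normal_cone_def)
qed

lemma polyhedral_cone_Int: "polyhedral_cone S \<Longrightarrow> polyhedral_cone T \<Longrightarrow> polyhedral_cone (S \<inter> T)"
  by (auto simp: polyhedral_cone_def convex_cone_iff)

lemma polyhedral_cone_halfspace: "polyhedral_cone {l. l \<bullet> a \<le> l \<bullet> b}"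
proof -
  have "{l. l \<bullet> a \<le> l \<bullet> b} = {l. (a - b) \<bullet> l \<le> 0}"
    by (auto simp: inner_diff_left inner_commute[of a] inner_commute[of b])
  then show ?thesis
    by (simp add: polyhedral_cone_def polyhedron_halfspace_le convex_cone_halfspace_le)
qed

lemma polyhedral_cone_INT:
  assumes "finite I" "\<And>i. i \<in> I \<Longrightarrow> polyhedral_cone (S i)"
  shows "polyhedral_cone (\<Inter>i\<in>I. S i)"
  using assms
  by (auto simp: polyhedral_cone_def intro!: polyhedron_Inter convex_cone_Inter)

lemma polyhedral_cone_halfspaces:
  assumes "polyhedral_cone K" "finite I"
  shows "polyhedral_cone {l \<in> K. \<forall>i\<in>I. l \<bullet> a i \<le> l \<bullet> b i}"
proof -
  have "{l \<in> K. \<forall>i\<in>I. l \<bullet> a i \<le> l \<bullet> b i} = K \<inter> (\<Inter>i\<in>I. {l. l \<bullet> a i \<le> l \<bullet> b i})" by auto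
  then show ?thesis
    by (simp add: polyhedral_cone_Int polyhedral_cone_INT polyhedral_cone_halfspace assms)
qed

lemma polyhedral_cone_closed: "polyhedral_cone K \<Longrightarrow> closed K"
  by (simp add: polyhedral_cone_def polyhedron_imp_closed)

lemma polyhedral_cone_convex: "polyhedral_cone K \<Longrightarrow> convex K"
  by (simp add: polyhedral_cone_def convex_cone_def)

lemma polyhedral_cone_normal_support:
  assumes "polyhedron P" "vertices P \<noteq> {}"
  shows "polyhedral_cone (normal_support P)"
proof -
  have "P \<noteq> {}" using assms vertices_subset by blast
  then show ?thesis using assms by (simp add: normal_support_eq polyhedral_cone_dual_recession_cone)
qed

lemma polyhedral_cone_inner_normal_cone:
  assumes "polyhedron P" "g \<in> vertices P"
  shows "polyhedral_cone (inner_normal_cone P g)"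
proof -
  have "vertices P \<noteq> {}" using assms by auto
  then show ?thesis
    unfolding inner_normal_cone_vertex[OF assms(2)]
    by (intro polyhedral_cone_halfspaces polyhedral_cone_normal_support finite_vertices assms(1))
qed

lemma interior_inner_normal_cone_nonempty:
  fixes P :: "(real^'n) set"
  assumes P: "polyhedron P" and g: "g \<in> vertices P"
  shows "interior (inner_normal_cone P g) \<noteq> {}"
proof -
  have ne: "vertices P \<noteq> {}" "P \<noteq> {}" using g vertices_subset by auto
  let ?R = "recession_cone P" and ?V = "vertices P"
  have fin: "finite ?V" using P by (rule finite_vertices)
  have R: "closed ?R" "convex_cone ?R" "pointed ?R"
    using closed_recession_cone[OF P ne(2)] convex_cone_recession_cone pointed_recession_cone[OF ne(1)]
    by blast+
  have "convex hull ?V \<subseteq> P"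
    using P by (intro hull_minimal vertices_subset polyhedron_imp_convex)
  then have sub: "{c + r | c r. c \<in> convex hull ?V \<and> r \<in> ?R} \<subseteq> P"
    using recession_coneD1 by blast
  have eq: "P = {c + r | c r. c \<in> convex hull ?V \<and> r \<in> ?R}"
    using Minkowski_Weyl[OF P R(3)] sub by blast
  have "g extreme_point_of {c + r | c r. c \<in> convex hull ?V \<and> r \<in> ?R}"
    using g unfolding eq[symmetric] by (simp add: vertices_def)
  then obtain l where l: "l \<in> dual_cone ?R" "\<And>h. h \<in> ?V \<Longrightarrow> h \<noteq> g \<Longrightarrow> l \<bullet> g < l \<bullet> h"
    using extreme_point_strictly_exposed[OF fin R(1,2)] by blast
  let ?U = "\<Inter>h\<in>?V - {g}. {l. (g - h) \<bullet> l < 0}"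
  have U: "open ?U" using fin by (intro open_INT) (auto simp: open_halfspace_lt)
  have "l \<in> ?U" using l(2) by (auto simp: inner_diff_left inner_commute[of _ l])
  \<comment> \<open>The exposing functional may lie on the boundary of the dual cone. Since the
    strict inequalities are open, it can be moved into the interior without violating them.\<close>
  moreover have "l \<in> closure (interior (dual_cone ?R))"
    using convex_closure_interior[of "dual_cone ?R"] interior_dual_cone_nonempty[OF R] l(1)
      convex_cone_dual_cone closure_subset by (fastforce simp: convex_cone_def)
  ultimately have "?U \<inter> interior (dual_cone ?R) \<noteq> {}"
    using open_Int_closure_eq_empty[OF U] by blast
  moreover have "?U \<inter> interior (dual_cone ?R) \<subseteq> inner_normal_cone P g"
  proof
    fix k assume k: "k \<in> ?U \<inter> interior (dual_cone ?R)"
    have "k \<bullet> g \<le> k \<bullet> h" if "h \<in> ?V" for h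
    proof (cases "h = g")
      case False
      with k that have "(g - h) \<bullet> k < 0" by blast
      then show ?thesis by (simp add: inner_diff_left inner_commute[of k])
    qed simp
    moreover have "k \<in> normal_support P"
      using k interior_subset normal_support_eq[OF P ne(1)] by blast
    ultimately show "k \<in> inner_normal_cone P g" unfolding inner_normal_cone_vertex[OF g] by blast
  qed
  ultimately show ?thesis using interior_maximal U by (metis open_Int open_interior subset_empty)
qed

text \<open>Tilting l slightly against x - g stays within the normal cone, whereas a tie between g
  and x would then turn into a win for x.\<close>

lemma interior_inner_normal_cone_less:
  fixes P :: "(real^'n) set"
  assumes l: "l \<in> interior (inner_normal_cone P g)" and x: "x \<in> P" "x \<noteq> g"
  shows "l \<bullet> g < l \<bullet> x"
proof -
  obtain e where e: "e > 0" "ball l e \<subseteq> inner_normal_cone P g"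
    using l by (meson mem_interior)
  define k where "k = l - (e / 2 / norm (x - g)) *\<^sub>R (x - g)"
  have n: "norm (x - g) > 0" using x by simp
  have "k \<in> ball l e" using e n by (simp add: k_def dist_norm)
  then have "k \<bullet> g \<le> k \<bullet> x" using e x by (auto simp: inner_normal_cone_def)
  then have "0 \<le> k \<bullet> (x - g)" by (simp add: inner_diff_right)
  moreover have "(e / 2 / norm (x - g)) * ((x - g) \<bullet> (x - g)) > 0"
    using e n by simp
  ultimately have "l \<bullet> (x - g) > 0" by (simp add: k_def inner_diff_left)
  then show ?thesis by (simp add: inner_diff_right)
qed

lemma extreme_point_if_interior:
  fixes P :: "(real^'n) set"
  assumes "g \<in> P" "interior (inner_normal_cone P g) \<noteq> {}"
  shows "g \<in> vertices P"
proof -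
  obtain l where "l \<in> interior (inner_normal_cone P g)" using assms by blast
  from interior_inner_normal_cone_less[OF this]
  have "P \<inter> {x. l \<bullet> x = l \<bullet> g} = {g}" "\<And>x. x \<in> P \<Longrightarrow> l \<bullet> x \<ge> l \<bullet> g"
    using assms(1) by (auto, force, metis less_eq_real_def)
  then show ?thesis
    using extreme_point_of_Int_supporting_hyperplane_ge[of P l "l \<bullet> g" g] by (simp add: vertices_def)
qed

section \<open>Comparing and prescribing normal supports\<close>

lemma recession_cone_subset_iff:
  assumes "polyhedron P" "vertices P \<noteq> {}" "polyhedron Q" "vertices Q \<noteq> {}"
  shows "recession_cone P \<subseteq> recession_cone Q \<longleftrightarrow> normal_support Q \<subseteq> normal_support P"
proof -
  have "P \<noteq> {}" "Q \<noteq> {}" using assms vertices_subset by blast+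
  then show ?thesis
    using dual_cone_dual_recession_cone assms dual_cone_antimono normal_support_eq by metis
qed

text \<open>The polyhedron is conv V plus the dual of L, written as the intersection of the
  translated duals g + K_g^*. In this form K_g lies in the normal cone of g by construction, and the
  interior hypothesis keeps every g a vertex.\<close>

lemma polyhedron_with_normal_fan:
  fixes V L :: "(real^'n) set"
  assumes V: "finite V" "V \<noteq> {}" and L: "polyhedral_cone L"
    and full: "\<And>g. g \<in> V \<Longrightarrow> interior {l \<in> L. \<forall>h\<in>V. l \<bullet> g \<le> l \<bullet> h} \<noteq> {}"
  obtains P where "polyhedron P" "vertices P = V" "normal_support P = L"
proof -
  define K where "K g = {l \<in> L. \<forall>h\<in>V. l \<bullet> g \<le> l \<bullet> h}" for g
  define P where "P = (\<Inter>g\<in>V. {x. \<forall>l\<in>K g. l \<bullet> g \<le> l \<bullet> x})"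
  have "polyhedral_cone (K g)" for g
    unfolding K_def using polyhedral_cone_halfspaces[OF L V(1)] .
  then have ex: "\<exists>G. finite G \<and> K g = convex_cone hull G" for g
    using polyhedral_cone_finitely_generated by metis
  have poly: "polyhedron {x. \<forall>l\<in>K g. l \<bullet> g \<le> l \<bullet> x}" for g
  proof -
    obtain G where G: "finite G" "K g = convex_cone hull G" using ex by blast
    have "{x. \<forall>l\<in>K g. l \<bullet> g \<le> l \<bullet> x} = {x. x - g \<in> dual_cone (K g)}"
      by (simp add: dual_cone_def inner_commute[of "_ - g"] inner_diff_right)
    also have "\<dots> = {x. x - g \<in> dual_cone G}"
      unfolding G dual_cone_convex_cone_hull ..
    also have "\<dots> = (\<Inter>l\<in>G. {x. l \<bullet> x \<ge> l \<bullet> g})"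
      by (auto simp: dual_cone_def inner_commute[of "_ - g"] inner_diff_right)
    finally show ?thesis using G by (auto intro!: polyhedron_Inter polyhedron_halfspace_ge)
  qed
  then have P: "polyhedron P" unfolding P_def using V by (auto intro!: polyhedron_Inter)
  have VP: "V \<subseteq> P" by (auto simp: P_def K_def)
  have KN: "K g \<subseteq> inner_normal_cone P g" if "g \<in> V" for g
    using that by (auto simp: P_def inner_normal_cone_def)
  have V_vert: "V \<subseteq> vertices P"
  proof
    fix g assume g: "g \<in> V"
    then have "interior (inner_normal_cone P g) \<noteq> {}"
      using KN full[OF g] interior_mono[OF KN[OF g]] unfolding K_def by blast
    then show "g \<in> vertices P" using extreme_point_if_interior g VP by blast
  qed
  then have ne: "vertices P \<noteq> {}" using V by blast
  have cover: "\<exists>g\<in>V. l \<in> K g" if "l \<in> L" for l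
  proof -
    obtain g where "g \<in> V" "\<And>h. h \<in> V \<Longrightarrow> l \<bullet> g \<le> l \<bullet> h"
      using V by (metis (no_types, lifting) arg_min_if_finite(1) arg_min_least)
    then show ?thesis using that by (auto simp: K_def)
  qed
  have rec: "dual_cone L \<subseteq> recession_cone P"
  proof
    fix d assume d: "d \<in> dual_cone L"
    have "l \<bullet> g \<le> l \<bullet> (x + t *\<^sub>R d)"
      if "x \<in> P" "0 \<le> t" "g \<in> V" "l \<in> K g" for x t g l
    proof -
      have "l \<bullet> g \<le> l \<bullet> x" using that by (auto simp: P_def)
      moreover have "0 \<le> t * (l \<bullet> d)"
        using d that by (auto simp: dual_cone_def K_def inner_commute)
      ultimately show ?thesis by (simp add: inner_add_right)
    qed
    then show "d \<in> recession_cone P" by (auto simp: recession_cone_def P_def)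
  qed
  have NL: "normal_support P = L"
  proof
    have "normal_support P \<subseteq> dual_cone (dual_cone L)"
      using dual_cone_antimono[OF rec] by (simp add: normal_support_eq[OF P ne])
    then show "normal_support P \<subseteq> L"
      using dual_cone_dual_cone[of L] polyhedral_cone_closed[OF L] L by (simp add: polyhedral_cone_def)
    show "L \<subseteq> normal_support P"
      using cover KN V_vert by (fastforce simp: normal_support_def)
  qed
  \<comment> \<open>An interior functional of the normal cone of a vertex x lies in L, hence also in
    some K_g. There x is the strict minimiser, so x = g.\<close>
  have vert_V: "vertices P \<subseteq> V"
  proof
    fix x assume x: "x \<in> vertices P"
    obtain l where l: "l \<in> interior (inner_normal_cone P x)"
      using interior_inner_normal_cone_nonempty[OF P x] by blast
    then have "l \<in> L" using NL x interior_subset by (auto simp: normal_support_def)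
    then obtain g where g: "g \<in> V" "l \<in> inner_normal_cone P g" using cover KN by blast
    have "x \<in> P" using x vertices_subset by blast
    then have "\<not> l \<bullet> x < l \<bullet> g" using g by (auto simp: inner_normal_cone_def not_less)
    then have "g = x" using interior_inner_normal_cone_less[OF l, of g] g VP by blast
    then show "x \<in> V" using g by simp
  qed
  show thesis
  proof (rule that[OF P _ NL])
    show "vertices P = V" using vert_V V_vert by blast
  qed
qed

section \<open>Normal cones of local solutions\<close>

text \<open>Finitely many hyperplanes have measure zero and therefore contain no nonempty open
  set.\<close>

lemma dense_off_hyperplanes:
  fixes U :: "(real^'n) set"
  assumes U: "open U" and A: "finite A" "0 \<notin> A"
  shows "U \<subseteq> closure (U - (\<Union>a\<in>A. {x. a \<bullet> x = 0}))"
proof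
  fix x assume x: "x \<in> U"
  let ?H = "\<Union>a\<in>A. {x. a \<bullet> x = 0}"
  show "x \<in> closure (U - ?H)"
    unfolding closure_iff_nhds_not_empty
  proof (intro allI impI)
    fix B W assume W: "W \<subseteq> B" "open W" "x \<in> W"
    have "negligible ?H"
    proof (intro negligible_Union ballI)
      show "finite ((\<lambda>a. {x. a \<bullet> x = 0}) ` A)" using A by simp
      fix T assume "T \<in> (\<lambda>a. {x. a \<bullet> x = 0}) ` A"
      then obtain a where "a \<in> A" "T = {x. a \<bullet> x = 0}" by blast
      then show "negligible T" using A negligible_hyperplane[of a 0] by auto
    qed
    moreover have "\<not> negligible (U \<inter> W)"
      using U W x by (intro open_not_negligible) auto
    ultimately have "\<not> U \<inter> W \<subseteq> ?H" using negligible_subset by blast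
    then show "(U - ?H) \<inter> B \<noteq> {}" using W by blast
  qed
qed

lemma finite_obtain_min:
  fixes f :: "'a \<Rightarrow> real"
  assumes "finite S" "S \<noteq> {}"
  obtains m where "m \<in> S" "\<And>k. k \<in> S \<Longrightarrow> f m \<le> f k"
  using arg_min_if_finite(1)[OF assms, of f] arg_min_least[OF assms, of _ f] by blast

lemma nfold_sum_const:
  fixes P :: "(real^'n) set"
  assumes "x \<in> P"
  shows "real i *\<^sub>R x \<in> (\<Sum>k<i. P)"
proof (induction i)
  case (Suc i)
  have "real (Suc i) *\<^sub>R x = real i *\<^sub>R x + x" by (simp add: scaleR_left_distrib)
  then show ?case using Suc assms by (auto intro: set_plus_intro)
qed simp

lemma nfold_sum_ge:
  fixes P :: "(real^'n) set"
  assumes "\<And>x. x \<in> P \<Longrightarrow> c \<le> l \<bullet> x" "y \<in> (\<Sum>k<i. P)"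
  shows "real i * c \<le> l \<bullet> y"
  using assms(2)
proof (induction i arbitrary: y)
  case (Suc i)
  then obtain a b where "a \<in> (\<Sum>k<i. P)" "b \<in> P" "y = a + b"
    by (auto elim: set_plus_elim)
  then show ?case using Suc.IH[of a] assms(1)[of b] by (simp add: inner_add_right algebra_simps)
qed simp

text \<open>The direction is absorbed by the last copy of P; for i = 0 there is no copy and the sum
  is the single point 0.\<close>

lemma nfold_sum_recession:
  fixes P :: "(real^'n) set"
  assumes "d \<in> recession_cone P" "y \<in> (\<Sum>k<i. P)" "0 < (i :: nat)" "0 \<le> t"
  shows "y + t *\<^sub>R d \<in> (\<Sum>k<i. P)"
proof -
  obtain j where j: "i = Suc j" using assms(3) gr0_implies_Suc by blast
  then obtain a b where ab: "a \<in> (\<Sum>k<j. P)" "b \<in> P" "y = a + b"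
    using assms(2) by (auto elim: set_plus_elim)
  have "y + t *\<^sub>R d = a + (b + t *\<^sub>R d)" using ab by (simp add: add.assoc)
  moreover have "a + (b + t *\<^sub>R d) \<in> (\<Sum>k<j. P) + P"
    using recession_coneD[OF assms(1) ab(2) assms(4)] ab(1) by (intro set_plus_intro)
  ultimately show ?thesis using j by (simp add: add.assoc)
qed

section \<open>Tropical roots at a vertex of the coefficient sum\<close>

text \<open>Only i is compared with the other exponents: since \<gamma> is the root of (i, j), the
  points for i and j coincide, so the minimum is attained at j too.\<close>

definition root_cone :: "(nat \<Rightarrow> (real^'n) set) \<Rightarrow> real^'n \<Rightarrow> real^'n \<Rightarrow> (real^'n) set" where
  "root_cone \<phi> v \<gamma> = {\<mu> \<in> inner_normal_cone (coeff_sum \<phi>) v.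
     \<exists>i\<in>Supp \<phi>. \<exists>j\<in>Supp \<phi>. i \<noteq> j \<and> \<gamma> = rho \<phi> v i j \<and>
       (\<forall>k\<in>Supp \<phi>. \<mu> \<bullet> (vertex_decomp \<phi> v i + real i *\<^sub>R \<gamma>)
         \<le> \<mu> \<bullet> (vertex_decomp \<phi> v k + real k *\<^sub>R \<gamma>))}"

text \<open>The tropical root equation for two monomials. The quotient formula for
  \<open>rho\<close> is the solution of this linear equation and is unfolded only here.\<close>

lemma rho_iff:
  assumes "i \<noteq> j"
  shows "\<gamma> = rho \<phi> v i j \<longleftrightarrow>
    vertex_decomp \<phi> v i + real i *\<^sub>R \<gamma> = vertex_decomp \<phi> v j + real j *\<^sub>R \<gamma>"
proof -
  define c where "c = real i - real j"
  have c: "c \<noteq> 0" using assms by (simp add: c_def)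
  let ?d = "vertex_decomp \<phi> v i - vertex_decomp \<phi> v j"
  have "\<gamma> = rho \<phi> v i j \<longleftrightarrow> c *\<^sub>R \<gamma> = c *\<^sub>R (- ((1 / c) *\<^sub>R ?d))"
    unfolding rho_def c_def[symmetric] using c by (simp only: scaleR_cancel_left) simp
  also have "\<dots> \<longleftrightarrow> c *\<^sub>R \<gamma> + ?d = 0"
    using c by (auto simp: algebra_simps)
  also have "\<dots> \<longleftrightarrow> vertex_decomp \<phi> v i + real i *\<^sub>R \<gamma> = vertex_decomp \<phi> v j + real j *\<^sub>R \<gamma>"
    by (simp add: c_def algebra_simps flip: eq_iff_diff_eq_0)
  finally show ?thesis .
qed

text \<open>What is retained of the semiring is that the coefficients are polyhedra.\<close>

locale coeff_sum_vertex =
  fixes \<phi> :: "nat \<Rightarrow> (real^'n) set" and v :: "real^'n"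
  assumes finite_Supp: "finite (Supp \<phi>)"
    and card_Supp: "2 \<le> card (Supp \<phi>)"
    and polyhedron_coeff: "\<And>i. i \<in> Supp \<phi> \<Longrightarrow> polyhedron (\<phi> i)"
    and vertex_v: "v \<in> vertices (coeff_sum \<phi>)"
begin

abbreviation "vd \<equiv> vertex_decomp \<phi> v"
abbreviation "N \<equiv> inner_normal_cone (coeff_sum \<phi>) v"

lemma vd: "i \<in> Supp \<phi> \<Longrightarrow> vd i \<in> vertices (\<phi> i)" "v = (\<Sum>i\<in>Supp \<phi>. vd i)"
  using theI'[OF vertex_decomp_ex1[OF finite_Supp vertex_v]] by (auto simp: vertex_decomp_def)

lemma vd_in: "i \<in> Supp \<phi> \<Longrightarrow> vd i \<in> \<phi> i"
  using vd(1) vertices_subset by blast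

text \<open>Minimising over a Minkowski sum splits into minimising over each summand; one inclusion
  exchanges a single component of the decomposition of v.\<close>

lemma normal_cone_eq: "N = (\<Inter>i\<in>Supp \<phi>. inner_normal_cone (\<phi> i) (vd i))"
proof (intro subset_antisym subsetI)
  fix l assume l: "l \<in> N"
  have "l \<bullet> vd i \<le> l \<bullet> x" if i: "i \<in> Supp \<phi>" and x: "x \<in> \<phi> i" for i x
  proof -
    let ?s = "vd(i := x)"
    have "sum ?s (Supp \<phi>) \<in> coeff_sum \<phi>"
      unfolding coeff_sum_def set_sum_alt[OF finite_Supp] using vd_in x by auto
    then have "l \<bullet> v \<le> l \<bullet> sum ?s (Supp \<phi>)" using l by (simp add: inner_normal_cone_def)
    moreover have "sum ?s (Supp \<phi>) = x + sum vd (Supp \<phi> - {i})"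
      using finite_Supp i by (simp add: sum.remove[of _ i])
    moreover have "v = vd i + sum vd (Supp \<phi> - {i})"
      using finite_Supp i vd(2) by (simp add: sum.remove[of _ i])
    then have "l \<bullet> v = l \<bullet> vd i + l \<bullet> sum vd (Supp \<phi> - {i})" by (metis inner_add_right)
    ultimately show ?thesis by (simp add: inner_add_right)
  qed
  then show "l \<in> (\<Inter>i\<in>Supp \<phi>. inner_normal_cone (\<phi> i) (vd i))" by (simp add: inner_normal_cone_def)
next
  fix l assume l: "l \<in> (\<Inter>i\<in>Supp \<phi>. inner_normal_cone (\<phi> i) (vd i))"
  have "l \<bullet> v \<le> l \<bullet> x" if x: "x \<in> coeff_sum \<phi>" for x
  proof -
    obtain s where s: "x = sum s (Supp \<phi>)" "\<forall>i\<in>Supp \<phi>. s i \<in> \<phi> i"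
      using x unfolding coeff_sum_def set_sum_alt[OF finite_Supp] by blast
    have "(\<Sum>i\<in>Supp \<phi>. l \<bullet> vd i) \<le> (\<Sum>i\<in>Supp \<phi>. l \<bullet> s i)"
      using l s by (intro sum_mono) (auto simp: inner_normal_cone_def)
    moreover have "l \<bullet> v = (\<Sum>i\<in>Supp \<phi>. l \<bullet> vd i)" by (metis inner_sum_right vd(2))
    ultimately show ?thesis using s by (simp add: inner_sum_right)
  qed
  then show "l \<in> N" by (simp add: inner_normal_cone_def)
qed

lemma polyhedral_cone_N: "polyhedral_cone N"
proof -
  have "polyhedral_cone (inner_normal_cone (\<phi> i) (vd i))" if "i \<in> Supp \<phi>" for i
    using polyhedral_cone_inner_normal_cone polyhedron_coeff[OF that] vd(1)[OF that] .
  then show ?thesis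
    by (subst normal_cone_eq) (rule polyhedral_cone_INT[OF finite_Supp])
qed

lemma summand_ge:
  assumes l: "l \<in> N" "l \<in> inner_normal_cone P g" and i: "i \<in> Supp \<phi>" and x: "x \<in> summand \<phi> P i"
  shows "l \<bullet> (vd i + real i *\<^sub>R g) \<le> l \<bullet> x"
proof -
  obtain a b where ab: "a \<in> \<phi> i" "b \<in> (\<Sum>k<i. P)" "x = a + b"
    using x by (auto simp: summand_def elim: set_plus_elim)
  have "N \<subseteq> inner_normal_cone (\<phi> i) (vd i)"
    by (subst normal_cone_eq) (rule INT_lower[OF i])
  then have "l \<in> inner_normal_cone (\<phi> i) (vd i)" using l(1) by (rule subsetD)
  then have "l \<bullet> vd i \<le> l \<bullet> a" using ab by (simp add: inner_normal_cone_def)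
  moreover have "real i * (l \<bullet> g) \<le> l \<bullet> b"
    using l(2) ab by (intro nfold_sum_ge) (auto simp: inner_normal_cone_def)
  ultimately show ?thesis using ab by (simp add: inner_add_right)
qed

lemma summand_mem: "i \<in> Supp \<phi> \<Longrightarrow> g \<in> P \<Longrightarrow> vd i + real i *\<^sub>R g \<in> summand \<phi> P i"
  unfolding summand_def by (intro set_plus_intro vd_in nfold_sum_const)

lemma summand_subset_evaluation: "i \<in> Supp \<phi> \<Longrightarrow> summand \<phi> P i \<subseteq> evaluation \<phi> P"
  unfolding evaluation_def closed_convex_hull_def
  by (rule order_trans[OF _ order_trans[OF hull_subset closure_subset]]) blast

lemma evaluation_minimal:
  assumes "closed X" "convex X" "\<And>i. i \<in> Supp \<phi> \<Longrightarrow> summand \<phi> P i \<subseteq> X"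
  shows "evaluation \<phi> P \<subseteq> X"
  unfolding evaluation_def closed_convex_hull_def
  using assms by (intro closure_minimal hull_minimal) auto

lemma evaluation_ge:
  assumes l: "l \<in> N" "l \<in> inner_normal_cone P g"
    and w: "\<And>i. i \<in> Supp \<phi> \<Longrightarrow> l \<bullet> w \<le> l \<bullet> (vd i + real i *\<^sub>R g)" and x: "x \<in> evaluation \<phi> P"
  shows "l \<bullet> w \<le> l \<bullet> x"
proof -
  have "evaluation \<phi> P \<subseteq> {x. l \<bullet> x \<ge> l \<bullet> w}"
    using summand_ge[OF l] w
    by (intro evaluation_minimal closed_halfspace_ge convex_halfspace_ge subsetI CollectI)
      (meson order_trans)
  then show ?thesis using x by blast
qed

text \<open>A finite union of polyhedral cones, one for each pair with root \<gamma>. Closedness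
  lets conclusions about generic functionals extend to whole normal cones.\<close>

lemma closed_root_cone: "closed (root_cone \<phi> v \<gamma>)"
proof -
  have "root_cone \<phi> v \<gamma> = (\<Union>(i, j)\<in>{(i, j) \<in> Supp \<phi> \<times> Supp \<phi>. i \<noteq> j \<and> \<gamma> = rho \<phi> v i j}.
      {\<mu> \<in> N. \<forall>k\<in>Supp \<phi>. \<mu> \<bullet> (vd i + real i *\<^sub>R \<gamma>) \<le> \<mu> \<bullet> (vd k + real k *\<^sub>R \<gamma>)})"
    by (auto simp: root_cone_def)
  moreover have "finite {(i, j) \<in> Supp \<phi> \<times> Supp \<phi>. i \<noteq> j \<and> \<gamma> = rho \<phi> v i j}"
    using finite_Supp by (auto intro: finite_subset[of _ "Supp \<phi> \<times> Supp \<phi>"])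
  moreover have "closed {\<mu> \<in> N. \<forall>k\<in>Supp \<phi>. \<mu> \<bullet> a \<le> \<mu> \<bullet> b k}" for a b
    using polyhedral_cone_closed[OF polyhedral_cone_halfspaces[OF polyhedral_cone_N finite_Supp]] .
  ultimately show ?thesis by auto
qed

text \<open>For a generic interior functional the minimising point \<open>?w\<close> of the
  evaluation is locally constant, hence a vertex. It then belongs to two summands, and in each of
  them it must be the point \<open>?p\<close>; equality of two such points says that g is their
  root. Density and closedness give the rest.\<close>

lemma local_solution_normal_cone:
  assumes sol: "local_solution \<phi> v P" and g: "g \<in> vertices P"
  shows "inner_normal_cone P g \<subseteq> root_cone \<phi> v g"
proof -
  let ?K = "inner_normal_cone P g" and ?p = "\<lambda>i. vd i + real i *\<^sub>R g"
  have P: "polyhedron P" and NP: "normal_support P \<subseteq> N"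
    using sol by (auto simp: local_solution_def is_solution_def)
  have gP: "g \<in> P" using g vertices_subset by blast
  have KN: "?K \<subseteq> N" using NP g by (auto simp: normal_support_def)
  \<comment> \<open>Off these hyperplanes a tie between two values of \<mu> at points
    \<open>?p\<close> can only come from the points being equal.\<close>
  define A where "A = (\<lambda>(i, k). ?p i - ?p k) ` (Supp \<phi> \<times> Supp \<phi>) - {0}"
  have A: "finite A" "0 \<notin> A" using finite_Supp by (auto simp: A_def)
  have "\<mu> \<in> root_cone \<phi> v g" if \<mu>: "\<mu> \<in> interior ?K - (\<Union>a\<in>A. {x. a \<bullet> x = 0})" for \<mu>
  proof -
    have \<mu>K: "\<mu> \<in> ?K" using \<mu> interior_subset by blast
    have "Supp \<phi> \<noteq> {}" using card_Supp by auto
    then obtain m where m: "m \<in> Supp \<phi>" "\<And>k. k \<in> Supp \<phi> \<Longrightarrow> \<mu> \<bullet> ?p m \<le> \<mu> \<bullet> ?p k"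
      using finite_obtain_min[OF finite_Supp, of "\<lambda>k. \<mu> \<bullet> ?p k"] by blast
    let ?w = "?p m" and ?E = "evaluation \<phi> P"
    have strict: "\<mu> \<bullet> ?w < \<mu> \<bullet> ?p k" if "k \<in> Supp \<phi>" "?p k \<noteq> ?w" for k
    proof -
      have "?w - ?p k \<in> A" using that m(1) by (force simp: A_def)
      then have "(?w - ?p k) \<bullet> \<mu> \<noteq> 0" using \<mu> by blast
      then have "\<mu> \<bullet> ?w \<noteq> \<mu> \<bullet> ?p k"
        by (simp add: inner_diff_right inner_commute[of _ \<mu>])
      then show ?thesis using m(2)[OF that(1)] by simp
    qed
    \<comment> \<open>A neighbourhood of \<mu> on which the same point \<open>?w\<close> stays
      minimal; it puts \<mu> in the interior of the normal cone of \<open>?w\<close>.\<close>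
    define U where "U = interior ?K \<inter> (\<Inter>k\<in>{k \<in> Supp \<phi>. ?p k \<noteq> ?w}. {l. (?w - ?p k) \<bullet> l < 0})"
    have "open U" unfolding U_def using finite_Supp
      by (intro open_Int open_INT ballI open_halfspace_lt) auto
    moreover have "\<mu> \<in> U"
      using \<mu> strict by (auto simp: U_def inner_diff_right inner_commute[of _ \<mu>])
    moreover have "U \<subseteq> inner_normal_cone ?E ?w"
    proof
      fix l assume l: "l \<in> U"
      then have lK: "l \<in> ?K" using interior_subset by (auto simp: U_def)
      have "l \<bullet> ?w \<le> l \<bullet> ?p k" if "k \<in> Supp \<phi>" for k
      proof (cases "?p k = ?w")
        case False
        then have "(?w - ?p k) \<bullet> l < 0" using l that by (auto simp: U_def)
        then show ?thesis by (simp add: inner_diff_right inner_commute[of _ l])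
      qed simp
      then show "l \<in> inner_normal_cone ?E ?w"
        using evaluation_ge[OF subsetD[OF KN lK] lK] by (simp add: inner_normal_cone_def)
    qed
    ultimately have \<mu>E: "\<mu> \<in> interior (inner_normal_cone ?E ?w)" by (rule interiorI)
    have "?w \<in> ?E" using summand_mem[OF m(1) gP] summand_subset_evaluation[OF m(1)] by blast
    then have "?w \<in> vertices ?E" using extreme_point_if_interior \<mu>E by blast
    then obtain i j where ij: "i \<in> Supp \<phi>" "j \<in> Supp \<phi>" "i \<noteq> j"
        "?w \<in> summand \<phi> P i" "?w \<in> summand \<phi> P j"
      using sol vertices_subset unfolding local_solution_def is_solution_def by blast
    \<comment> \<open>The summand k has minimal value at \<open>?p k\<close>, so that value is at
      most the one at \<open>?w\<close>; but \<open>?w\<close> is the strict minimiser over the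
      evaluation.\<close>
    have eq: "?p k = ?w" if "k \<in> Supp \<phi>" "?w \<in> summand \<phi> P k" for k
    proof (rule ccontr)
      assume "?p k \<noteq> ?w"
      moreover have "?p k \<in> ?E"
        using summand_mem[OF that(1) gP] summand_subset_evaluation[OF that(1)] by blast
      ultimately have "\<mu> \<bullet> ?w < \<mu> \<bullet> ?p k" using interior_inner_normal_cone_less[OF \<mu>E] by blast
      then show False using summand_ge[OF _ \<mu>K that] \<mu>K KN by force
    qed
    have "?p i = ?p j" using eq[OF ij(1,4)] eq[OF ij(2,5)] by simp
    then have "g = rho \<phi> v i j" by (rule rho_iff[OF ij(3), THEN iffD2])
    moreover have "\<forall>k\<in>Supp \<phi>. \<mu> \<bullet> ?p i \<le> \<mu> \<bullet> ?p k" using m(2) eq[OF ij(1,4)] by simp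
    ultimately show ?thesis using ij \<mu>K KN unfolding root_cone_def by blast
  qed
  then have "closure (interior ?K - (\<Union>a\<in>A. {x. a \<bullet> x = 0})) \<subseteq> root_cone \<phi> v g"
    by (intro closure_minimal closed_root_cone) blast
  then have "interior ?K \<subseteq> root_cone \<phi> v g"
    using dense_off_hyperplanes[OF open_interior A] by blast
  then have "closure (interior ?K) \<subseteq> root_cone \<phi> v g"
    by (intro closure_minimal closed_root_cone)
  moreover have "closure (interior ?K) = closure ?K"
    using polyhedral_cone_convex[OF polyhedral_cone_inner_normal_cone[OF P g]]
      interior_inner_normal_cone_nonempty[OF P g] by (rule convex_closure_interior)
  ultimately show ?thesis using closure_subset by blast
qed

text \<open>The evaluation is conv G plus the recession cone of P. A vertex w is exposed by a
  functional in N(P); at the vertex g of P which this functional selects, the root condition makes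
  two exponents share a minimal point of G, and that point must be w.\<close>

lemma local_solutionI:
  assumes P: "polyhedron P" "vertices P \<noteq> {}" and NP: "normal_support P \<subseteq> N"
    and root: "\<And>g. g \<in> vertices P \<Longrightarrow> inner_normal_cone P g \<subseteq> root_cone \<phi> v g"
  shows "local_solution \<phi> v P"
proof -
  let ?V = "vertices P" and ?R = "recession_cone P" and ?E = "evaluation \<phi> P"
  define G where "G = (\<lambda>(i, g). vd i + real i *\<^sub>R g) ` (Supp \<phi> \<times> ?V)"
  define X where "X = {c + r | c r. c \<in> convex hull G \<and> r \<in> ?R}"
  have VP: "?V \<subseteq> P" by (rule vertices_subset)
  have Pne: "P \<noteq> {}" using P VP by blast
  have finG: "finite G" using finite_Supp finite_vertices[OF P(1)] by (simp add: G_def)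
  have R: "closed ?R" "convex_cone ?R"
    using closed_recession_cone[OF P(1) Pne] convex_cone_recession_cone by auto
  have X: "closed X" "convex X"
    unfolding X_def using closed_hull_plus_cone[OF finG R(1)] R(2)
    by (auto intro!: convex_sum_cone simp: convex_cone_def)
  have GE: "G \<subseteq> ?E"
  proof
    fix x assume "x \<in> G"
    then obtain i g where "i \<in> Supp \<phi>" "g \<in> P" "x = vd i + real i *\<^sub>R g"
      using VP by (auto simp: G_def)
    then show "x \<in> ?E" using summand_mem[of i g P] summand_subset_evaluation[of i P] by blast
  qed
  have gR: "g + r \<in> X" if "g \<in> G" "r \<in> ?R" for g r
    unfolding X_def using hull_inc[OF that(1)] that(2) by blast
  \<comment> \<open>A summand point outside X would be separated from X by a functional bounded
    below on X. Such a functional lies in N(P), where the minimum over the summand is attained in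
    G.\<close>
  have EX: "?E \<subseteq> X"
  proof (rule evaluation_minimal[OF X], rule subsetI, rule ccontr)
    fix i x assume i: "i \<in> Supp \<phi>" and x: "x \<in> summand \<phi> P i" "x \<notin> X"
    obtain l b where lb: "l \<bullet> x < b" "\<And>y. y \<in> X \<Longrightarrow> b < l \<bullet> y"
      using separating_hyperplane_closed_point[OF X(2,1) x(2)] by blast
    obtain g0 where g0: "g0 \<in> G" using i P by (auto simp: G_def)
    have "0 \<le> l \<bullet> r" if "r \<in> ?R" for r
    proof (rule nonneg_if_bounded_below_on_ray[where b = b and c = "l \<bullet> g0"])
      fix t :: real assume "0 \<le> t"
      then have "b < l \<bullet> (g0 + t *\<^sub>R r)"
        using g0 convex_cone_scaleR[OF R(2) _ that] by (intro lb(2) gR)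
      then show "b \<le> l \<bullet> g0 + t * (l \<bullet> r)" by (simp add: inner_add_right)
    qed
    then have l: "l \<in> normal_support P" by (simp add: normal_support_eq[OF P] dual_cone_def)
    then obtain g where g: "g \<in> ?V" "l \<in> inner_normal_cone P g" by (rule normal_support_cases)
    have "vd i + real i *\<^sub>R g \<in> G" using i g by (auto simp: G_def)
    then have "b < l \<bullet> (vd i + real i *\<^sub>R g)"
      using lb(2) gR[of _ 0] convex_cone_contains_0[OF R(2)] by force
    then show False using summand_ge[OF _ g(2) i x(1)] l NP lb(1) by force
  qed
  have E: "closed ?E" "convex ?E"
    by (auto simp: evaluation_def closed_convex_hull_def convex_closure)
  have "?R \<subseteq> recession_cone ?E"
  proof
    fix d assume d: "d \<in> ?R"
    \<comment> \<open>Only a summand with i > 0 contains a copy of P to absorb d; two exponents in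
      the support guarantee one.\<close>
    have "\<not> Supp \<phi> \<subseteq> {0}" using card_Supp card_mono[of "{0}" "Supp \<phi>"] by auto
    then obtain i where i: "i \<in> Supp \<phi>" "0 < i" by blast
    obtain g where g: "g \<in> P" using Pne by blast
    show "d \<in> recession_cone ?E"
    proof (rule recession_coneI[OF E, where z = "vd i + real i *\<^sub>R g"])
      show "vd i + real i *\<^sub>R g \<in> ?E" using summand_mem[OF i(1) g] summand_subset_evaluation[OF i(1)] by blast
      fix t :: real assume "0 \<le> t"
      then have "vd i + (real i *\<^sub>R g + t *\<^sub>R d) \<in> summand \<phi> P i"
        unfolding summand_def using i d g
        by (intro set_plus_intro vd_in nfold_sum_recession nfold_sum_const)
      then show "vd i + real i *\<^sub>R g + t *\<^sub>R d \<in> ?E"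
        using summand_subset_evaluation[OF i(1)] by (auto simp: add.assoc)
    qed
  qed
  moreover have "convex hull G \<subseteq> ?E" using GE E(2) by (rule hull_minimal)
  ultimately have "X \<subseteq> ?E" unfolding X_def using recession_coneD1 by blast
  with EX have EX: "?E = X" by blast
  have "\<exists>i\<in>Supp \<phi>. \<exists>j\<in>Supp \<phi>. i \<noteq> j \<and> w \<in> vertices (summand \<phi> P i) \<and> w \<in> vertices (summand \<phi> P j)"
    if w: "w \<in> vertices ?E" for w
  proof -
    have "w extreme_point_of {c + r | c r. c \<in> convex hull G \<and> r \<in> ?R}"
      using w unfolding EX X_def by (simp add: vertices_def)
    then obtain l where l: "w \<in> G" "l \<in> dual_cone ?R" "\<And>g. g \<in> G \<Longrightarrow> g \<noteq> w \<Longrightarrow> l \<bullet> w < l \<bullet> g"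
      using extreme_point_strictly_exposed[OF finG R] by blast
    then have "l \<in> normal_support P" by (simp add: normal_support_eq[OF P])
    then obtain g where g: "g \<in> ?V" "l \<in> inner_normal_cone P g" by (rule normal_support_cases)
    then obtain i j where ij: "i \<in> Supp \<phi>" "j \<in> Supp \<phi>" "i \<noteq> j" "g = rho \<phi> v i j"
      "\<And>k. k \<in> Supp \<phi> \<Longrightarrow> l \<bullet> (vd i + real i *\<^sub>R g) \<le> l \<bullet> (vd k + real k *\<^sub>R g)"
      using root unfolding root_cone_def by blast
    obtain k h where kh: "k \<in> Supp \<phi>" "h \<in> ?V" "w = vd k + real k *\<^sub>R h"
      using l(1) by (auto simp: G_def)
    \<comment> \<open>Replacing the vertex h in w by the selected vertex g does not increase the
      value of l, so w is no better than the minimum at g.\<close>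
    have "l \<bullet> g \<le> l \<bullet> h" using g kh VP by (auto simp: inner_normal_cone_def)
    then have "real k * (l \<bullet> g) \<le> real k * (l \<bullet> h)" by (simp add: mult_left_mono)
    then have "l \<bullet> (vd k + real k *\<^sub>R g) \<le> l \<bullet> w" using kh by (simp add: inner_add_right)
    then have "l \<bullet> (vd i + real i *\<^sub>R g) \<le> l \<bullet> w" using ij(5)[OF kh(1)] by linarith
    moreover have "vd i + real i *\<^sub>R g \<in> G" using ij g by (auto simp: G_def)
    ultimately have wi: "w = vd i + real i *\<^sub>R g" using l(3) by force
    then have wj: "w = vd j + real j *\<^sub>R g" using ij rho_iff by metis
    have ext: "w \<in> vertices (summand \<phi> P m)" if "w \<in> summand \<phi> P m" "m \<in> Supp \<phi>" for m
      using w that summand_subset_evaluation[of m P] by (auto simp: vertices_def extreme_point_of_def)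
    have "w \<in> summand \<phi> P i" "w \<in> summand \<phi> P j"
      using summand_mem[OF ij(1), of g P] summand_mem[OF ij(2), of g P] wi wj g VP by auto
    then show ?thesis using ext ij by blast
  qed
  then show ?thesis using P NP by (auto simp: local_solution_def is_solution_def)
qed

end

section \<open>The fan of a central arrangement\<close>

lemma full_dimensional_iff:
  fixes S :: "(real^'n) set"
  assumes "convex S"
  shows "full_dimensional S \<longleftrightarrow> interior S \<noteq> {}"
proof
  assume "full_dimensional S"
  then have "affine hull S = UNIV" by (simp add: full_dimensional_def flip: aff_dim_eq_full)
  then have "rel_interior S = interior S" "S \<noteq> {}" by (auto simp: rel_interior_interior)
  then show "interior S \<noteq> {}" using rel_interior_eq_empty[OF assms] by simp
next
  assume "interior S \<noteq> {}"
  then show "full_dimensional S" using aff_dim_nonempty_interior by (force simp: full_dimensional_def)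
qed

text \<open>Hyperplanes are represented by normals, so A may contain several normals of one
  hyperplane; this is the source of the parallel case in the facet argument.\<close>

locale arrangement_fan =
  fixes A :: "(real^'n) set" and N :: "(real^'n) set"
  assumes finite_normals: "finite A" and nonzero_normals: "0 \<notin> A"
    and closed_N: "closed N" and convex_N: "convex N"
begin

definition off :: "(real^'n) set" where
  "off = {x. \<forall>a\<in>A. a \<bullet> x \<noteq> 0}"

text \<open>The open region through x: a positive product says that x and y are strictly on the same
  side.\<close>

definition cell :: "real^'n \<Rightarrow> (real^'n) set" where
  "cell x = {y. \<forall>a\<in>A. 0 < (a \<bullet> x) * (a \<bullet> y)}"

definition closed_cell :: "real^'n \<Rightarrow> (real^'n) set" where
  "closed_cell x = {y. \<forall>a\<in>A. 0 \<le> (a \<bullet> x) * (a \<bullet> y)}"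

definition fan_cones :: "(real^'n) set set" where
  "fan_cones = (\<lambda>x. closed_cell x \<inter> N) ` (interior N \<inter> off)"

lemma fan_cones_cases:
  assumes "C \<in> fan_cones"
  obtains x where "x \<in> interior N" "x \<in> off" "C = closed_cell x \<inter> N"
  using assms by (auto simp: fan_cones_def)

lemma off_eq: "off = - (\<Union>a\<in>A. {x. a \<bullet> x = 0})"
  by (auto simp: off_def)

lemma open_cell: "open (cell x)"
proof -
  have "cell x = (\<Inter>a\<in>A. {y. ((a \<bullet> x) *\<^sub>R a) \<bullet> y > 0})" by (auto simp: cell_def)
  then show ?thesis using finite_normals by (simp only:) (intro open_INT ballI open_halfspace_gt)
qed

lemma convex_cell: "convex (cell x)"
proof -
  have "cell x = (\<Inter>a\<in>A. {y. ((a \<bullet> x) *\<^sub>R a) \<bullet> y > 0})" by (auto simp: cell_def)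
  then show ?thesis by (simp only:) (intro convex_INT convex_halfspace_gt)
qed

lemma closed_cell_INT: "closed_cell x = (\<Inter>a\<in>A. {y. ((a \<bullet> x) *\<^sub>R a) \<bullet> y \<ge> 0})"
  by (auto simp: closed_cell_def)

lemma closed_closed_cell: "closed (closed_cell x)"
  unfolding closed_cell_INT by (intro closed_INT ballI closed_halfspace_ge)

lemma convex_closed_cell: "convex (closed_cell x)"
  unfolding closed_cell_INT by (intro convex_INT convex_halfspace_ge)

lemma cell_subset: "cell x \<subseteq> closed_cell x" "cell x \<subseteq> off"
  by (auto simp: cell_def closed_cell_def intro: less_imp_le) (auto simp: off_def)

lemma mem_cell: "x \<in> off \<Longrightarrow> x \<in> cell x"
  by (auto simp: cell_def off_def zero_less_mult_iff)

lemma closed_cell_cong: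
  assumes "y \<in> cell x"
  shows "closed_cell y = closed_cell x"
proof -
  have "0 \<le> (a \<bullet> y) * (a \<bullet> z) \<longleftrightarrow> 0 \<le> (a \<bullet> x) * (a \<bullet> z)" if "a \<in> A" for a z
  proof -
    have "0 < (a \<bullet> x) * (a \<bullet> y)" using assms that by (simp add: cell_def)
    then show ?thesis by (auto simp: zero_le_mult_iff zero_less_mult_iff)
  qed
  then show ?thesis by (simp add: closed_cell_def)
qed

lemma closed_cell_off:
  assumes "y \<in> closed_cell x" "x \<in> off" "y \<in> off"
  shows "y \<in> cell x"
  unfolding cell_def
proof (intro CollectI ballI)
  fix a assume "a \<in> A"
  then have "0 \<le> (a \<bullet> x) * (a \<bullet> y)" "a \<bullet> x \<noteq> 0" "a \<bullet> y \<noteq> 0"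
    using assms by (auto simp: closed_cell_def off_def)
  then show "0 < (a \<bullet> x) * (a \<bullet> y)" by (simp add: less_le)
qed

lemma closure_cell:
  assumes "x \<in> off"
  shows "closure (cell x) = closed_cell x"
proof
  show "closure (cell x) \<subseteq> closed_cell x"
    by (intro closure_minimal cell_subset closed_closed_cell)
  show "closed_cell x \<subseteq> closure (cell x)"
  proof
    fix y assume y: "y \<in> closed_cell x"
    \<comment> \<open>Adding a small multiple of x makes every weak sign condition on y
      strict.\<close>
    define f where "f n = y + inverse (real (Suc n)) *\<^sub>R x" for n
    have "f n \<in> cell x" for n
      unfolding cell_def
    proof (intro CollectI ballI)
      fix a assume a: "a \<in> A"
      have "0 < (a \<bullet> x) * (a \<bullet> x)" using mem_cell[OF assms] a by (simp add: cell_def)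
      then have "0 < inverse (real (Suc n)) * ((a \<bullet> x) * (a \<bullet> x))" by simp
      moreover have "0 \<le> (a \<bullet> x) * (a \<bullet> y)" using y a by (simp add: closed_cell_def)
      moreover have "(a \<bullet> x) * (a \<bullet> f n) = (a \<bullet> x) * (a \<bullet> y) + inverse (real (Suc n)) * ((a \<bullet> x) * (a \<bullet> x))"
        by (simp add: f_def inner_add_right distrib_left del: of_nat_Suc)
      ultimately show "0 < (a \<bullet> x) * (a \<bullet> f n)" by linarith
    qed
    moreover have "f \<longlonglongrightarrow> y + 0 *\<^sub>R x"
      unfolding f_def by (intro tendsto_intros LIMSEQ_inverse_real_of_nat)
    ultimately show "y \<in> closure (cell x)" unfolding closure_sequential by auto
  qed
qed

lemma interior_closed_cell:
  assumes "x \<in> off"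
  shows "interior (closed_cell x) \<subseteq> cell x"
proof
  fix y assume y: "y \<in> interior (closed_cell x)"
  have "0 < (a \<bullet> x) * (a \<bullet> y)" if a: "a \<in> A" for a
  proof -
    have nz: "(a \<bullet> x) *\<^sub>R a \<noteq> 0" using a assms nonzero_normals by (auto simp: off_def)
    have "closed_cell x \<subseteq> {y. ((a \<bullet> x) *\<^sub>R a) \<bullet> y \<ge> 0}" using a by (auto simp: closed_cell_def)
    then have "y \<in> interior {y. ((a \<bullet> x) *\<^sub>R a) \<bullet> y \<ge> 0}" using y interior_mono by blast
    then show ?thesis using interior_halfspace_ge[OF nz, of 0] by simp
  qed
  then show "y \<in> cell x" by (simp add: cell_def)
qed

text \<open>Cells are convex and so connected, while a connected set meeting two sides of a
  hyperplane meets the hyperplane itself.\<close>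

lemma components_complement: "components (- (\<Union>a\<in>A. {x. a \<bullet> x = 0})) = cell ` off"
proof -
  have "connected_component_set off x = cell x" if x: "x \<in> off" for x
  proof
    show "cell x \<subseteq> connected_component_set off x"
      by (intro connected_component_maximal mem_cell x convex_connected convex_cell cell_subset)
    show "connected_component_set off x \<subseteq> cell x"
    proof
      fix y assume y: "y \<in> connected_component_set off x"
      have "0 < (a \<bullet> x) * (a \<bullet> y)" if a: "a \<in> A" for a
      proof (rule ccontr)
        assume "\<not> 0 < (a \<bullet> x) * (a \<bullet> y)"
        then have "a \<bullet> x \<le> 0 \<and> 0 \<le> a \<bullet> y \<or> a \<bullet> y \<le> 0 \<and> 0 \<le> a \<bullet> x"
          by (auto simp: zero_less_mult_iff not_less)
        moreover have "x \<in> connected_component_set off x" using x by simp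
        ultimately obtain z where "z \<in> connected_component_set off x" "a \<bullet> z = 0"
          using connected_ivt_hyperplane[OF connected_connected_component, of _ off x] y by metis
        then show False using connected_component_subset[of off x] a by (auto simp: off_def)
      qed
      then show "y \<in> cell x" by (simp add: cell_def)
    qed
  qed
  then show ?thesis unfolding components_def off_eq[symmetric] by (intro image_cong refl)
qed

lemma full_dimensional_cells_eq:
  "{closure R \<inter> N | R. R \<in> components (- (\<Union>a\<in>A. {x. a \<bullet> x = 0})) \<and>
      full_dimensional (closure R \<inter> N)} = fan_cones"
proof -
  have "{closure R \<inter> N | R. R \<in> cell ` off \<and> full_dimensional (closure R \<inter> N)}
      = {closed_cell x \<inter> N | x. x \<in> off \<and> interior (closed_cell x \<inter> N) \<noteq> {}}"
  proof (intro subset_antisym subsetI)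
    fix C assume "C \<in> {closure R \<inter> N | R. R \<in> cell ` off \<and> full_dimensional (closure R \<inter> N)}"
    then obtain x where "x \<in> off" "C = closed_cell x \<inter> N" "full_dimensional C"
      using closure_cell by auto
    then show "C \<in> {closed_cell x \<inter> N | x. x \<in> off \<and> interior (closed_cell x \<inter> N) \<noteq> {}}"
      using full_dimensional_iff[OF convex_Int[OF convex_closed_cell convex_N]] by blast
  next
    fix C assume "C \<in> {closed_cell x \<inter> N | x. x \<in> off \<and> interior (closed_cell x \<inter> N) \<noteq> {}}"
    then obtain x where "x \<in> off" "C = closed_cell x \<inter> N" "full_dimensional C"
      using full_dimensional_iff[OF convex_Int[OF convex_closed_cell convex_N]] by blast
    then show "C \<in> {closure R \<inter> N | R. R \<in> cell ` off \<and> full_dimensional (closure R \<inter> N)}"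
      using closure_cell[of x] by (intro CollectI exI[of _ "cell x"]) auto
  qed
  also have "\<dots> = fan_cones"
  proof (intro subset_antisym subsetI)
    fix C assume "C \<in> {closed_cell x \<inter> N | x. x \<in> off \<and> interior (closed_cell x \<inter> N) \<noteq> {}}"
    then obtain x y where x: "x \<in> off" "C = closed_cell x \<inter> N" and y: "y \<in> interior (closed_cell x \<inter> N)"
      by blast
    \<comment> \<open>The representative x of the region need not lie in N. The interior point y
      does, and it represents the same region.\<close>
    then have "y \<in> interior N" "y \<in> cell x" using interior_closed_cell[OF x(1)] by auto
    then show "C \<in> fan_cones" using closed_cell_cong x(2) cell_subset unfolding fan_cones_def by blast
  next
    fix C assume "C \<in> fan_cones"
    then obtain x where x: "x \<in> interior N" "x \<in> off" "C = closed_cell x \<inter> N" by (rule fan_cones_cases)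
    have "x \<in> interior (closed_cell x)"
      using interior_maximal[OF cell_subset(1) open_cell] mem_cell[OF x(2)] by blast
    then show "C \<in> {closed_cell x \<inter> N | x. x \<in> off \<and> interior (closed_cell x \<inter> N) \<noteq> {}}"
      using x by auto
  qed
  finally show ?thesis by (simp only: components_complement)
qed

lemma interior_fan_cone: "x \<in> interior N \<Longrightarrow> x \<in> off \<Longrightarrow> x \<in> interior (closed_cell x \<inter> N)"
  using interior_maximal[OF cell_subset(1)[of x] open_cell] mem_cell[of x] by auto

lemma mem_fan_cone: "x \<in> interior N \<Longrightarrow> x \<in> off \<Longrightarrow> x \<in> closed_cell x \<inter> N"
  by (rule subsetD[OF interior_subset interior_fan_cone])

lemma interior_fan_cone_nonempty:
  assumes "C \<in> fan_cones"
  shows "interior C \<noteq> {}"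
proof -
  obtain x where x: "x \<in> interior N" "x \<in> off" "C = closed_cell x \<inter> N"
    using fan_cones_cases[OF assms] .
  then have "x \<in> interior C" using interior_fan_cone by simp
  then show ?thesis by auto
qed

lemma closed_fan_cone:
  assumes "C \<in> fan_cones"
  shows "closed C"
proof -
  obtain x where "C = closed_cell x \<inter> N" using fan_cones_cases[OF assms] .
  then show ?thesis by (simp only:) (intro closed_Int closed_closed_cell closed_N)
qed

lemma fan_cone_unique:
  assumes "C \<in> fan_cones" "x \<in> C" "x \<in> off"
  shows "C = closed_cell x \<inter> N"
proof -
  obtain y where "y \<in> off" "C = closed_cell y \<inter> N" using fan_cones_cases[OF assms(1)] by blast
  moreover from this have "x \<in> cell y" using assms(2,3) by (intro closed_cell_off) auto
  ultimately show ?thesis using closed_cell_cong by simp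
qed

text \<open>A fan cone is determined by the set of normals that are positive on its open
  region.\<close>

lemma finite_fan_cones: "finite fan_cones"
proof -
  let ?g = "\<lambda>B. {y. \<forall>a\<in>A. if a \<in> B then 0 \<le> a \<bullet> y else a \<bullet> y \<le> 0} \<inter> N"
  have "fan_cones \<subseteq> ?g ` Pow A"
  proof
    fix C assume C: "C \<in> fan_cones"
    obtain x where x: "x \<in> off" "C = closed_cell x \<inter> N" using fan_cones_cases[OF C] by blast
    have "(if a \<in> {a \<in> A. 0 < a \<bullet> x} then 0 \<le> a \<bullet> y else a \<bullet> y \<le> 0) \<longleftrightarrow> 0 \<le> (a \<bullet> x) * (a \<bullet> y)"
      if "a \<in> A" for a y
    proof -
      have "a \<bullet> x \<noteq> 0" using x(1) that by (simp add: off_def)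
      then show ?thesis using that by (cases "0 < a \<bullet> x") (auto simp: zero_le_mult_iff)
    qed
    then have "C = ?g {a \<in> A. 0 < a \<bullet> x}" unfolding x(2) closed_cell_def by simp
    then show "C \<in> ?g ` Pow A" by (rule image_eqI) auto
  qed
  then show ?thesis by (rule finite_subset) (simp add: finite_normals)
qed

section \<open>Convex unions of fan cones and adjacency through facets\<close>

definition adapted :: "(real^'n) set \<Rightarrow> bool" where
  "adapted D \<longleftrightarrow> closed D \<and> convex D \<and> D \<subseteq> N \<and>
     (\<forall>x\<in>interior N \<inter> off. x \<in> D \<longrightarrow> closed_cell x \<inter> N \<subseteq> D)"

text \<open>A normal of the arrangement keeps its weak sign on a closed cell, so an inequality that
  holds at one point off the hyperplanes holds on its whole cone.\<close>

lemma adapted_halfspaces: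
  assumes "\<And>b. b \<in> B \<Longrightarrow> b = 0 \<or> b \<in> A \<or> - b \<in> A"
  shows "adapted {y \<in> N. \<forall>b\<in>B. 0 \<le> b \<bullet> y}"
proof -
  have eq: "{y \<in> N. \<forall>b\<in>B. 0 \<le> b \<bullet> y} = N \<inter> (\<Inter>b\<in>B. {y. b \<bullet> y \<ge> 0})" by auto
  have "0 \<le> b \<bullet> y" if "x \<in> off" "y \<in> closed_cell x" "b \<in> B" "0 \<le> b \<bullet> x" for x y b
  proof -
    have "b = 0 \<or> b \<in> A \<or> - b \<in> A" using assms that(3) by blast
    then consider "b = 0" | "b \<in> A" | "- b \<in> A" by blast
    then show ?thesis
    proof cases
      case 2
      then have "0 \<le> (b \<bullet> x) * (b \<bullet> y)" "b \<bullet> x \<noteq> 0"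
        using that(1,2) by (auto simp: closed_cell_def off_def)
      then show ?thesis using that(4) by (auto simp: zero_le_mult_iff)
    next
      case 3
      then have "0 \<le> (- b \<bullet> x) * (- b \<bullet> y)" "- b \<bullet> x \<noteq> 0"
        using that(1,2) unfolding closed_cell_def off_def by blast+
      then show ?thesis using that(4) by (auto simp: zero_le_mult_iff)
    qed simp
  qed
  then show ?thesis
    unfolding adapted_def eq
    by (intro conjI closed_Int convex_Int closed_N convex_N closed_INT convex_INT ballI
        closed_halfspace_ge convex_halfspace_ge) auto
qed

lemma adapted_eq_Union:
  assumes D: "adapted D" "interior D \<noteq> {}"
  shows "D = \<Union>{C \<in> fan_cones. C \<subseteq> D}"
proof
  let ?U = "\<Union>{C \<in> fan_cones. C \<subseteq> D}" and ?H = "\<Union>a\<in>A. {x. a \<bullet> x = 0}"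
  have sub: "interior D - ?H \<subseteq> ?U"
  proof
    fix x assume x: "x \<in> interior D - ?H"
    have xo: "x \<in> off" using x by (auto simp: off_def)
    have xN: "x \<in> interior N" using x D(1) interior_mono by (auto simp: adapted_def)
    have "x \<in> D" using x interior_subset by blast
    then have "closed_cell x \<inter> N \<subseteq> D" using D(1) xo xN unfolding adapted_def by blast
    then show "x \<in> ?U" using mem_fan_cone[OF xN xo] xo xN unfolding fan_cones_def by blast
  qed
  have cl: "closed ?U" using finite_fan_cones closed_fan_cone by (intro closed_Union) auto
  have "interior D \<subseteq> ?U"
    using dense_off_hyperplanes[OF open_interior finite_normals nonzero_normals, of D]
      closure_minimal[OF sub cl] by blast
  then have "closure (interior D) \<subseteq> ?U" using cl by (rule closure_minimal)
  moreover have "closure (interior D) = closure D"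
    using D by (intro convex_closure_interior) (auto simp: adapted_def)
  ultimately show "D \<subseteq> ?U" using closure_subset by blast
qed blast

text \<open>A segment between two chambers can be chosen to meet the hyperplanes one at a time
  (up to parallel normals), so it leaves a given collection of cones through a common facet.\<close>

lemma adjacent_cones:
  assumes D: "adapted D" and X: "\<X> \<subseteq> fan_cones"
    and C1: "C1 \<in> \<X>" "C1 \<subseteq> D" and C2: "C2 \<in> fan_cones" "C2 \<notin> \<X>" "C2 \<subseteq> D"
  obtains C C' f where "C \<in> \<X>" "C \<subseteq> D" "C' \<in> fan_cones" "C' \<notin> \<X>" "C' \<subseteq> D"
    "f facet_of C" "f facet_of C'" "\<And>C''. C'' \<in> fan_cones \<Longrightarrow> f facet_of C'' \<Longrightarrow> C'' = C \<or> C'' = C'"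
proof -
  obtain a0 where a0: "a0 \<in> interior N" "a0 \<in> off" "C1 = closed_cell a0 \<inter> N"
    using C1 X fan_cones_cases by blast
  obtain b0 where b0: "b0 \<in> interior N" "b0 \<in> off" "C2 = closed_cell b0 \<inter> N"
    using C2 fan_cones_cases by blast
  \<comment> \<open>The combination of a and a' that vanishes at a0. If both normals vanish at one
    further point of the segment, c (a, a') vanishes at b as well; choosing b off the hyperplanes in
    B then forces c (a, a') = 0, so a and a' are parallel.\<close>
  define c where "c = (\<lambda>(a, a'). (a0 \<bullet> a') *\<^sub>R a - (a0 \<bullet> a) *\<^sub>R a')"
  define B where "B = c ` (A \<times> A) - {0}"
  have B: "finite B" "0 \<notin> B" using finite_normals by (auto simp: B_def)
  have "b0 \<in> closure ((cell b0 \<inter> interior N) - (\<Union>b\<in>B. {x. b \<bullet> x = 0}))"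
    using dense_off_hyperplanes[OF open_Int[OF open_cell open_interior] B] mem_cell b0 by blast
  then have "(cell b0 \<inter> interior N) - (\<Union>b\<in>B. {x. b \<bullet> x = 0}) \<noteq> {}"
    using closure_empty by force
  then obtain b where b: "b \<in> cell b0" "b \<in> interior N" "\<And>z. z \<in> B \<Longrightarrow> z \<bullet> b \<noteq> 0"
    by blast
  have b_off: "b \<in> off" and C2b: "C2 = closed_cell b \<inter> N"
    using subsetD[OF cell_subset(2) b(1)] closed_cell_cong[OF b(1)] b0(3) by auto
  define p where "p t = a0 + t *\<^sub>R (b - a0)" for t :: real
  have p01: "p 0 = a0" "p 1 = b" by (simp_all add: p_def)
  have cont_p: "continuous_on UNIV p" unfolding p_def by (intro continuous_intros)
  have pD: "p t \<in> interior D" if "0 \<le> t" "t \<le> 1" for t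
  proof -
    have "a0 \<in> interior D" "b \<in> interior D"
      using interior_fan_cone[OF a0(1,2)] interior_fan_cone[OF b(2) b_off] interior_mono C1 C2 a0(3) C2b
      by blast+
    moreover have "convex (interior D)" using D convex_interior by (auto simp: adapted_def)
    ultimately have "(1 - t) *\<^sub>R a0 + t *\<^sub>R b \<in> interior D" using that by (intro convexD) auto
    then show ?thesis by (simp add: p_def algebra_simps)
  qed
  have intDN: "interior D \<subseteq> interior N" using D interior_mono by (auto simp: adapted_def)
  let ?X = "\<Union>{C \<in> \<X>. C \<subseteq> D}"
  define T where "T = {0..1} \<inter> p -` ?X"
  have clX: "closed ?X"
    using finite_subset[OF X finite_fan_cones] X closed_fan_cone by (intro closed_Union) auto
  have "closed T" unfolding T_def using cont_p
    by (intro closed_Int closed_atLeastAtMost closed_vimage clX) auto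
  moreover have T0: "0 \<in> T" using C1 mem_fan_cone[OF a0(1,2)] a0(3) by (auto simp: T_def p01)
  moreover have bdd: "bdd_above T" unfolding T_def by (rule bdd_above_Int1) simp
  ultimately have ST: "Sup T \<in> T" using closed_contains_Sup by blast
  \<comment> \<open>The last parameter at which the segment is still in the collection.\<close>
  define s where "s = Sup T"
  have s: "s \<in> T" "\<And>t. t \<in> T \<Longrightarrow> t \<le> s" using ST cSup_upper[OF _ bdd] by (auto simp: s_def)
  have "1 \<notin> T"
  proof
    assume "1 \<in> T"
    then obtain C where "C \<in> \<X>" "b \<in> C" by (auto simp: T_def p01)
    then have "C = C2" using fan_cone_unique[OF _ _ b_off] X C2b by blast
    then show False using \<open>C \<in> \<X>\<close> C2 by blast
  qed
  then have s01: "0 \<le> s" "s < 1" using s(1) by (auto simp: T_def less_le)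
  obtain C where C: "C \<in> \<X>" "C \<subseteq> D" "p s \<in> C" using s(1) by (auto simp: T_def)
  then obtain x where x: "x \<in> off" "C = closed_cell x \<inter> N" using X fan_cones_cases by blast
  \<comment> \<open>Z holds the normals vanishing at the exit point, and W is a neighbourhood of
    that point where all other normals keep their signs.\<close>
  define Z where "Z = {a \<in> A. a \<bullet> p s = 0}"
  define W where "W = interior N \<inter> (\<Inter>a\<in>A - Z. {y. ((a \<bullet> p s) *\<^sub>R a) \<bullet> y > 0})"
  have openW: "open W" unfolding W_def using finite_normals
    by (intro open_Int open_interior open_INT ballI open_halfspace_gt) auto
  have pW: "p s \<in> W"
    using pD[of s] s01 intDN by (auto simp: W_def Z_def zero_less_mult_iff)
  have WA: "0 < (a \<bullet> p s) * (a \<bullet> y)" if "y \<in> W" "a \<in> A - Z" for a y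
    using that by (auto simp: W_def)
  have "open (p -` W)" using open_vimage[OF openW cont_p] .
  then obtain \<delta> where \<delta>: "\<delta> > 0" "ball s \<delta> \<subseteq> p -` W"
    using pW open_contains_ball by (metis vimageI2)
  \<comment> \<open>Half of \<delta> keeps both neighbours in W, and the bound 1 - s keeps q on the
    segment. The point q' may lie before a0; it only has to be in W.\<close>
  define \<eta> where "\<eta> = min (\<delta> / 2) (1 - s)"
  have \<eta>: "0 < \<eta>" "\<eta> < \<delta>" "s + \<eta> \<le> 1" using \<delta> s01 by (auto simp: \<eta>_def)
  define q where "q = p (s + \<eta>)"
  define q' where "q' = p (s - \<eta>)"
  have qW: "q \<in> W" "q' \<in> W" using \<delta>(2) \<eta> by (auto simp: q_def q'_def dist_real_def subset_iff)
  have qD: "q \<in> interior D" unfolding q_def using pD s01 \<eta> by auto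
  have Zdir: "a \<bullet> (b - a0) \<noteq> 0" "a \<bullet> q = \<eta> * (a \<bullet> (b - a0))" "a \<bullet> q' = - \<eta> * (a \<bullet> (b - a0))"
    if "a \<in> Z" for a
  proof -
    have e: "a \<bullet> a0 + s * (a \<bullet> (b - a0)) = 0" "a \<bullet> a0 \<noteq> 0"
      using that a0(2) by (auto simp: Z_def off_def p_def inner_add_right)
    then show "a \<bullet> (b - a0) \<noteq> 0" by auto
    show "a \<bullet> q = \<eta> * (a \<bullet> (b - a0))" "a \<bullet> q' = - \<eta> * (a \<bullet> (b - a0))"
      using e(1) by (simp_all add: q_def q'_def p_def inner_add_right distrib_right left_diff_distrib)
  qed
  have q_off: "q \<in> off"
    unfolding off_def
  proof (intro CollectI ballI)
    fix a assume "a \<in> A"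
    then show "a \<bullet> q \<noteq> 0" using Zdir[of a] WA[OF qW(1), of a] \<eta>(1) by (cases "a \<in> Z") auto
  qed
  define C' where "C' = closed_cell q \<inter> N"
  have qN: "q \<in> interior N" using qD intDN by blast
  have C'fan: "C' \<in> fan_cones" using qN q_off by (auto simp: C'_def fan_cones_def)
  have C'D: "C' \<subseteq> D" using D qD qN q_off interior_subset unfolding adapted_def C'_def by blast
  have C'X: "C' \<notin> \<X>"
  proof
    assume "C' \<in> \<X>"
    then have "s + \<eta> \<in> T"
      using mem_fan_cone[OF qN q_off] C'D \<eta> s01 by (auto simp: T_def C'_def q_def)
    then show False using s(2) \<eta>(1) by force
  qed
  have side: "closed_cell y = closed_cell z"
    if yz: "y \<in> off" "p s \<in> closed_cell y" "z \<in> W" "\<And>a. a \<in> Z \<Longrightarrow> 0 < (a \<bullet> z) * (a \<bullet> y)" for y z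
  proof -
    have "0 < (a \<bullet> z) * (a \<bullet> y)" if a: "a \<in> A" for a
    proof (cases "a \<in> Z")
      case False
      then have "0 < (a \<bullet> p s) * (a \<bullet> z)" "0 \<le> (a \<bullet> y) * (a \<bullet> p s)" "a \<bullet> y \<noteq> 0"
        using WA[OF yz(3), of a] yz(1,2) a by (auto simp: closed_cell_def off_def)
      then show ?thesis by (auto simp: zero_less_mult_iff zero_le_mult_iff)
    qed (use yz(4) in auto)
    then have "y \<in> cell z" by (simp add: cell_def)
    then show ?thesis by (rule closed_cell_cong)
  qed
  have "Z \<noteq> {}"
  proof
    assume "Z = {}"
    then have "closed_cell x = closed_cell q" using side[OF x(1) _ qW(1)] C x by auto
    then show False using C'X C(1) x(2) by (simp add: C'_def)
  qed
  then obtain a where a: "a \<in> Z" by blast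
  have aA: "a \<in> A" "a \<bullet> a0 \<noteq> 0" "a \<bullet> p s = 0" using a a0(2) by (auto simp: Z_def off_def)
  have "s \<noteq> 0" using aA by (auto simp: p01)
  have parallel: "\<exists>k. k \<noteq> 0 \<and> a' = k *\<^sub>R a" if a': "a' \<in> Z" for a'
  proof -
    have a'A: "a' \<in> A" "a' \<bullet> a0 \<noteq> 0" "a' \<bullet> p s = 0" using a' a0(2) by (auto simp: Z_def off_def)
    have "c (a, a') \<bullet> a0 = 0"
      unfolding c_def by (simp add: inner_diff_left inner_commute[of a0 a] inner_commute[of a0 a'])
    moreover have "c (a, a') \<bullet> p s = 0" using aA a'A by (simp add: c_def inner_diff_left)
    ultimately have "s * (c (a, a') \<bullet> b) = 0" by (simp add: p_def inner_add_right inner_diff_right)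
    then have "c (a, a') \<bullet> b = 0" using \<open>s \<noteq> 0\<close> by simp
    then have "c (a, a') = 0" using b(3) aA a'A by (force simp: B_def)
    then have "(a0 \<bullet> a) *\<^sub>R a' = (a0 \<bullet> a') *\<^sub>R a" by (simp add: c_def)
    then have "inverse (a0 \<bullet> a) *\<^sub>R ((a0 \<bullet> a) *\<^sub>R a') = inverse (a0 \<bullet> a) *\<^sub>R ((a0 \<bullet> a') *\<^sub>R a)" by simp
    then have "a' = (inverse (a0 \<bullet> a) * (a0 \<bullet> a')) *\<^sub>R a" using aA by (simp add: inner_commute)
    then show ?thesis using aA a'A by (metis inner_commute inverse_nonzero_iff_nonzero mult_eq_0_iff)
  qed
  \<comment> \<open>As all normals in Z are multiples of a, the sign of a alone decides which of the
    two sides a cell at the exit point lies on.\<close>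
  have sideZ: "closed_cell y = closed_cell z"
    if "y \<in> off" "p s \<in> closed_cell y" "z \<in> W" "0 < (a \<bullet> z) * (a \<bullet> y)" for y z
  proof (rule side[OF that(1-3)])
    fix a' assume "a' \<in> Z"
    then obtain k where k: "k \<noteq> 0" "a' = k *\<^sub>R a" using parallel by blast
    have "(a' \<bullet> z) * (a' \<bullet> y) = (k * k) * ((a \<bullet> z) * (a \<bullet> y))" using k by simp
    moreover have "k * k > 0" using k(1) by (metis not_real_square_gt_zero)
    ultimately show "0 < (a' \<bullet> z) * (a' \<bullet> y)" using that(4) by simp
  qed
  have two: "closed_cell y = closed_cell q \<or> closed_cell y = closed_cell q'"
    if "y \<in> off" "p s \<in> closed_cell y" for y
  proof -
    have "a \<bullet> y \<noteq> 0" using that aA by (auto simp: off_def)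
    then have "0 < (a \<bullet> q) * (a \<bullet> y) \<or> 0 < (a \<bullet> q') * (a \<bullet> y)"
      using Zdir[OF a] \<eta>(1) by (auto simp: zero_less_mult_iff mult_less_0_iff)
    then show ?thesis using sideZ[OF that] qW by blast
  qed
  have Cq': "C = closed_cell q' \<inter> N"
    using two[OF x(1)] C x(2) C'X by (auto simp: C'_def)
  \<comment> \<open>No side of the hyperplane of a is mentioned, so the same set serves as a facet
    of both adjacent cones.\<close>
  define f where "f = {y \<in> N. a \<bullet> y = 0 \<and> (\<forall>a'\<in>A - Z. 0 \<le> (a' \<bullet> p s) * (a' \<bullet> y))}"
  have facet: "f facet_of (closed_cell z \<inter> N)" if z: "z \<in> W" "z \<in> off" "interior (closed_cell z \<inter> N) \<noteq> {}" for z
  proof -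
    let ?C = "closed_cell z \<inter> N"
    have feq: "f = ?C \<inter> {y. ((a \<bullet> z) *\<^sub>R a) \<bullet> y = 0}"
    proof (intro subset_antisym subsetI)
      fix y assume y: "y \<in> f"
      have "0 \<le> (a' \<bullet> z) * (a' \<bullet> y)" if a': "a' \<in> A" for a'
      proof (cases "a' \<in> Z")
        case True
        then obtain k where "a' = k *\<^sub>R a" using parallel by blast
        then show ?thesis using y by (simp add: f_def)
      next
        case False
        then have "0 < (a' \<bullet> p s) * (a' \<bullet> z)" "0 \<le> (a' \<bullet> p s) * (a' \<bullet> y)"
          using WA[OF z(1)] a' y by (auto simp: f_def)
        then show ?thesis by (auto simp: zero_less_mult_iff zero_le_mult_iff)
      qed
      then show "y \<in> ?C \<inter> {y. ((a \<bullet> z) *\<^sub>R a) \<bullet> y = 0}" using y by (auto simp: f_def closed_cell_def)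
    next
      fix y assume y: "y \<in> ?C \<inter> {y. ((a \<bullet> z) *\<^sub>R a) \<bullet> y = 0}"
      have "a \<bullet> z \<noteq> 0" using z(2) aA by (auto simp: off_def)
      then have "a \<bullet> y = 0" using y by simp
      moreover have "0 \<le> (a' \<bullet> p s) * (a' \<bullet> y)" if "a' \<in> A - Z" for a'
      proof -
        have "0 < (a' \<bullet> p s) * (a' \<bullet> z)" "0 \<le> (a' \<bullet> z) * (a' \<bullet> y)"
          using WA[OF z(1) that] that y by (auto simp: closed_cell_def)
        then show ?thesis by (auto simp: zero_less_mult_iff zero_le_mult_iff)
      qed
      ultimately show "y \<in> f" using y by (auto simp: f_def)
    qed
    have "f face_of ?C"
      unfolding feq using aA(1)
      by (intro face_of_Int_supporting_hyperplane_ge convex_Int convex_closed_cell convex_N)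
        (auto simp: closed_cell_def)
    moreover have pf: "p s \<in> f"
    proof -
      have "p s \<in> N" using pW interior_subset by (auto simp: W_def)
      then show ?thesis using aA by (simp add: f_def)
    qed
    moreover have "aff_dim f = int CARD('n) - 1"
    proof -
      let ?h = "{y. a \<bullet> y = 0}"
      have a_nz: "a \<noteq> 0" using aA nonzero_normals by auto
      have dh: "aff_dim ?h = int CARD('n) - 1" using aff_dim_hyperplane[OF a_nz, of 0] by simp
      \<comment> \<open>Near the exit point the remaining sign conditions hold strictly, so f
        contains an open piece of the hyperplane and has its dimension.\<close>
      have "?h \<inter> W \<subseteq> f" using WA interior_subset by (fastforce simp: f_def W_def)
      moreover have "affine hull (?h \<inter> W) = affine hull ?h"
        using pW aA(3) by (intro affine_hull_convex_Int_open convex_hyperplane openW) auto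
      then have "aff_dim (?h \<inter> W) = aff_dim ?h" by (metis aff_dim_affine_hull)
      ultimately have "aff_dim ?h \<le> aff_dim f" using aff_dim_subset by metis
      moreover have "aff_dim f \<le> aff_dim ?h" by (intro aff_dim_subset) (auto simp: f_def)
      ultimately show ?thesis using dh by simp
    qed
    moreover have "aff_dim ?C = int CARD('n)" using aff_dim_nonempty_interior[OF z(3)] by simp
    ultimately show ?thesis unfolding facet_of_def by auto
  qed
  have q'_off: "q' \<in> off"
    unfolding off_def
  proof (intro CollectI ballI)
    fix a assume "a \<in> A"
    then show "a \<bullet> q' \<noteq> 0" using Zdir[of a] WA[OF qW(2), of a] \<eta>(1) by (cases "a \<in> Z") auto
  qed
  have fC: "f facet_of C"
    using facet[OF qW(2) q'_off] interior_fan_cone_nonempty[of C] C X unfolding Cq' by blast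
  have fC': "f facet_of C'"
    using facet[OF qW(1) q_off] interior_fan_cone_nonempty[OF C'fan] unfolding C'_def by blast
  have pf: "p s \<in> f" using pW aA interior_subset by (auto simp: f_def W_def)
  have "C'' = C \<or> C'' = C'" if C'': "C'' \<in> fan_cones" "f facet_of C''" for C''
  proof -
    obtain y where y: "y \<in> off" "C'' = closed_cell y \<inter> N" using fan_cones_cases[OF C''(1)] by blast
    have "p s \<in> C''" using facet_of_imp_subset[OF C''(2)] pf by blast
    then show ?thesis using two[OF y(1)] y(2) Cq' C'_def by auto
  qed
  then show thesis using that C C'fan C'X C'D fC fC' by blast
qed

end

section \<open>Local compatible systems and root regions\<close>

lemma LCS_roots_image: "LCS_roots \<phi> v t I = (\<lambda>k. rho_pair \<phi> v (I k)) ` {1..t}"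
  unfolding LCS_roots_def by (rule Setcompr_eq_image)

lemma finite_LCS_roots: "finite (LCS_roots \<phi> v t I)"
  by (simp add: LCS_roots_image)

context coeff_sum_vertex
begin

text \<open>Removing 0 corresponds to removing \<open>UNIV\<close> from
  \<open>arrangement\<close>.\<close>

definition normals :: "(real^'n) set" where
  "normals =
     {(vd k + real k *\<^sub>R rho \<phi> v i j) - (vd i + real i *\<^sub>R rho \<phi> v i j) | i j k.
        i \<in> Supp \<phi> \<and> j \<in> Supp \<phi> \<and> k \<in> Supp \<phi> \<and> i \<noteq> j} \<union>
     {rho \<phi> v i j - rho \<phi> v i' j' | i j i' j'.
        i \<in> Supp \<phi> \<and> j \<in> Supp \<phi> \<and> i' \<in> Supp \<phi> \<and> j' \<in> Supp \<phi> \<and> i \<noteq> j \<and> i' \<noteq> j'} - {0}"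

lemma finite_normals: "finite normals"
proof -
  let ?S = "Supp \<phi>"
  have 1: "finite {f i j k | i j k. i \<in> ?S \<and> j \<in> ?S \<and> k \<in> ?S \<and> i \<noteq> j}"
    for f :: "nat \<Rightarrow> nat \<Rightarrow> nat \<Rightarrow> real^'n"
    by (rule finite_subset[of _ "\<Union>i\<in>?S. \<Union>j\<in>?S. \<Union>k\<in>?S. {f i j k}"])
      (blast, simp add: finite_Supp)
  have 2: "finite {f i j i' j' | i j i' j'. i \<in> ?S \<and> j \<in> ?S \<and> i' \<in> ?S \<and> j' \<in> ?S \<and> i \<noteq> j \<and> i' \<noteq> j'}"
    for f :: "nat \<Rightarrow> nat \<Rightarrow> nat \<Rightarrow> nat \<Rightarrow> real^'n"
    by (rule finite_subset[of _ "\<Union>i\<in>?S. \<Union>j\<in>?S. \<Union>i'\<in>?S. \<Union>j'\<in>?S. {f i j i' j'}"])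
      (blast, simp add: finite_Supp)
  show ?thesis unfolding normals_def by (intro finite_Diff finite_UnI 1 2)
qed

lemma hyperplane1_eq: "hyperplane1 \<phi> v i j k =
    {x. ((vd k + real k *\<^sub>R rho \<phi> v i j) - (vd i + real i *\<^sub>R rho \<phi> v i j)) \<bullet> x = 0}"
  unfolding hyperplane1_def by (simp add: inner_diff_right inner_commute[of "_ - _"])

lemma hyperplane2_eq: "hyperplane2 \<phi> v i j i' j' = {x. (rho \<phi> v i j - rho \<phi> v i' j') \<bullet> x = 0}"
  unfolding hyperplane2_def by (simp add: inner_diff_right inner_commute[of "_ - _"])

lemma arrangement_eq: "arrangement \<phi> v = (\<lambda>a. {x. a \<bullet> x = 0}) ` normals"
proof -
  let ?h = "\<lambda>a::real^'n. {x. a \<bullet> x = 0}"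
  have nz: "?h a = UNIV \<longleftrightarrow> a = 0" for a :: "real^'n"
    by (auto simp: set_eq_iff)
  have D: "?h ` (X - {0}) = ?h ` X - {UNIV}" for X
    using nz by blast
  have im3: "?h ` {f i j k | i j k. Q i j k} = {?h (f i j k) | i j k. Q i j k}"
    for f :: "nat \<Rightarrow> nat \<Rightarrow> nat \<Rightarrow> real^'n" and Q by blast
  have im4: "?h ` {f i j k l | i j k l. Q i j k l} = {?h (f i j k l) | i j k l. Q i j k l}"
    for f :: "nat \<Rightarrow> nat \<Rightarrow> nat \<Rightarrow> nat \<Rightarrow> real^'n" and Q by blast
  show ?thesis
    unfolding arrangement_def normals_def hyperplane1_eq hyperplane2_eq D image_Un im3 im4 ..
qed

lemma convex_N: "convex N" and closed_N: "closed N"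
  by (rule polyhedral_cone_convex polyhedral_cone_closed, rule polyhedral_cone_N)+

sublocale fan: arrangement_fan normals N
  by unfold_locales (simp_all add: finite_normals convex_N closed_N, simp add: normals_def)

lemma maximal_cones_eq: "maximal_cones \<phi> v = fan.fan_cones"
  unfolding maximal_cones_def arrangement_eq fan.full_dimensional_cells_eq[symmetric] ..

definition is_root :: "real^'n \<Rightarrow> bool" where
  "is_root g \<longleftrightarrow> (\<exists>i\<in>Supp \<phi>. \<exists>j\<in>Supp \<phi>. i \<noteq> j \<and> g = rho \<phi> v i j)"

text \<open>The cone \<open>D_\<gamma>\<close> of the introduction.\<close>

definition root_region :: "(real^'n) set \<Rightarrow> real^'n \<Rightarrow> (real^'n) set" where
  "root_region V g = {\<mu> \<in> root_cone \<phi> v g. \<forall>h\<in>V. \<mu> \<bullet> g \<le> \<mu> \<bullet> h}"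

lemma root_cone_subset: "root_cone \<phi> v g \<subseteq> N"
  by (auto simp: root_cone_def)

lemma root_region_subset: "root_region V g \<subseteq> root_cone \<phi> v g" "root_region V g \<subseteq> N"
  using root_cone_subset by (auto simp: root_region_def)

text \<open>On C the roots g and h take equal values; if they differed, C would lie in a hyperplane.
  So a full-dimensional cone determines its root within V.\<close>

lemma root_region_unique:
  assumes "interior C \<noteq> {}" "C \<subseteq> root_region V g" "C \<subseteq> root_region V h" "g \<in> V" "h \<in> V"
  shows "g = h"
proof (rule ccontr)
  assume "g \<noteq> h"
  have "\<mu> \<bullet> g = \<mu> \<bullet> h" if "\<mu> \<in> C" for \<mu>
    using assms that by (auto simp: root_region_def intro!: antisym)
  then have "C \<subseteq> {\<mu>. (g - h) \<bullet> \<mu> = 0}"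
    by (auto simp: inner_diff_left inner_commute[of g] inner_commute[of h])
  then have "interior C \<subseteq> interior {\<mu>. (g - h) \<bullet> \<mu> = 0}" by (rule interior_mono)
  then show False using assms(1) \<open>g \<noteq> h\<close> by simp
qed

lemma inner_normal_cone_root_region:
  assumes "local_solution \<phi> v P" "g \<in> vertices P"
  shows "inner_normal_cone P g \<subseteq> root_region (vertices P) g"
  using local_solution_normal_cone[OF assms] inner_normal_cone_vertex[OF assms(2)]
  by (auto simp: root_region_def)

text \<open>A functional interior to the normal cone of g lies in the region of some h a priori.
  Both g and h minimise it over the vertices, and strictness in the interior gives h = g; closedness
  covers the boundary.\<close>

lemma local_solution_if_normal_support_subset:
  assumes P: "polyhedron P" "vertices P \<noteq> {}"
    and sub: "normal_support P \<subseteq> (\<Union>g\<in>vertices P. root_region (vertices P) g)"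
  shows "local_solution \<phi> v P"
proof (rule local_solutionI[OF P])
  show "normal_support P \<subseteq> N" using sub root_region_subset by blast
  fix g assume g: "g \<in> vertices P"
  have "interior (inner_normal_cone P g) \<subseteq> root_cone \<phi> v g"
  proof
    fix l assume l: "l \<in> interior (inner_normal_cone P g)"
    then have "l \<in> normal_support P" using g interior_subset by (auto simp: normal_support_def)
    then obtain h where h: "h \<in> vertices P" "l \<in> root_region (vertices P) h" using sub by blast
    have "h = g"
    proof (rule ccontr)
      assume "h \<noteq> g"
      then have "l \<bullet> g < l \<bullet> h"
        using h(1) vertices_subset by (intro interior_inner_normal_cone_less[OF l]) blast+
      then show False using h(2) g by (force simp: root_region_def)
    qed
    then show "l \<in> root_cone \<phi> v g" using h(2) root_region_subset by blast
  qed
  then have "closure (interior (inner_normal_cone P g)) \<subseteq> root_cone \<phi> v g"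
    by (intro closure_minimal closed_root_cone)
  moreover have "closure (interior (inner_normal_cone P g)) = closure (inner_normal_cone P g)"
    using polyhedral_cone_convex[OF polyhedral_cone_inner_normal_cone[OF P(1) g]]
      interior_inner_normal_cone_nonempty[OF P(1) g] by (rule convex_closure_interior)
  ultimately show "inner_normal_cone P g \<subseteq> root_cone \<phi> v g" using closure_subset by blast
qed

end

section \<open>Consequences of genericity\<close>

locale generic_coeff_sum_vertex = coeff_sum_vertex +
  assumes generic: "generic \<phi>"
begin

text \<open>The point where genericity is used: the pair behind a root is unique up to order, and
  both orders give the same minimal point. The union over pairs thus collapses to one polyhedral
  cone.\<close>

lemma root_cone_rho:
  assumes ij: "i \<in> Supp \<phi>" "j \<in> Supp \<phi>" "i \<noteq> j"
  shows "root_cone \<phi> v (rho \<phi> v i j) = {\<mu> \<in> N. \<forall>k\<in>Supp \<phi>.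
    \<mu> \<bullet> (vd i + real i *\<^sub>R rho \<phi> v i j) \<le> \<mu> \<bullet> (vd k + real k *\<^sub>R rho \<phi> v i j)}"
proof -
  let ?r = "rho \<phi> v i j"
  have "vd i' + real i' *\<^sub>R ?r = vd i + real i *\<^sub>R ?r"
    if i': "i' \<in> Supp \<phi>" "j' \<in> Supp \<phi>" "i' \<noteq> j'" "?r = rho \<phi> v i' j'" for i' j'
  proof -
    have "{i, j} = {i', j'}" using generic vertex_v ij i' unfolding generic_def by blast
    then have "i' = i \<or> i' = j" by blast
    moreover have "vd i + real i *\<^sub>R ?r = vd j + real j *\<^sub>R ?r" using rho_iff[OF ij(3)] by blast
    ultimately show ?thesis by auto
  qed
  then show ?thesis unfolding root_cone_def using ij by (intro Collect_cong conj_cong refl) (metis (no_types, lifting))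
qed

lemma primary_label_iff:
  assumes "i \<in> Supp \<phi>" "j \<in> Supp \<phi>" "i \<noteq> j" "C \<subseteq> N"
  shows "primary_label \<phi> v C (i, j) \<longleftrightarrow> C \<subseteq> root_cone \<phi> v (rho \<phi> v i j)"
  unfolding root_cone_rho[OF assms(1-3)] primary_label_def prod.case using assms(4) by blast

text \<open>The minimality inequalities have normals of the first kind of hyperplane, the
  comparisons with other roots those of the second kind; this is why the region is a union of fan
  cones.\<close>

lemma root_region_halfspaces:
  assumes V: "finite V" "\<And>h. h \<in> V \<Longrightarrow> is_root h" and g: "g \<in> V"
  obtains B where "finite B" "root_region V g = {\<mu> \<in> N. \<forall>b\<in>B. 0 \<le> b \<bullet> \<mu>}"
    "\<forall>b\<in>B. b = 0 \<or> b \<in> normals"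
proof -
  obtain i j where ij: "i \<in> Supp \<phi>" "j \<in> Supp \<phi>" "i \<noteq> j" "g = rho \<phi> v i j"
    using V(2)[OF g] by (auto simp: is_root_def)
  define B1 where "B1 = (\<lambda>k. (vd k + real k *\<^sub>R g) - (vd i + real i *\<^sub>R g)) ` Supp \<phi>"
  define B2 where "B2 = (\<lambda>h. h - g) ` V"
  have b1: "b = 0 \<or> b \<in> normals" if b: "b \<in> B1" for b
  proof -
    obtain k where "k \<in> Supp \<phi>" "b = (vd k + real k *\<^sub>R g) - (vd i + real i *\<^sub>R g)"
      using b by (auto simp: B1_def)
    then show ?thesis using ij unfolding normals_def by blast
  qed
  have b2: "b = 0 \<or> b \<in> normals" if b: "b \<in> B2" for b
  proof -
    obtain h where h: "h \<in> V" "b = h - g" using b by (auto simp: B2_def)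
    obtain i' j' where "i' \<in> Supp \<phi>" "j' \<in> Supp \<phi>" "i' \<noteq> j'" "h = rho \<phi> v i' j'"
      using V(2)[OF h(1)] by (auto simp: is_root_def)
    then show ?thesis using ij h(2) unfolding normals_def by blast
  qed
  show thesis
  proof (rule that[of "B1 \<union> B2"])
    show "finite (B1 \<union> B2)" using V(1) finite_Supp by (simp add: B1_def B2_def)
    show "\<forall>b\<in>B1 \<union> B2. b = 0 \<or> b \<in> normals" using b1 b2 by blast
    have le: "0 \<le> (p - q) \<bullet> \<mu> \<longleftrightarrow> \<mu> \<bullet> q \<le> \<mu> \<bullet> p" for p q \<mu> :: "real^'n"
      by (simp add: inner_diff_left inner_commute[of \<mu>])
    show "root_region V g = {\<mu> \<in> N. \<forall>b\<in>B1 \<union> B2. 0 \<le> b \<bullet> \<mu>}"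
      unfolding root_region_def root_cone_rho[OF ij(1-3), folded ij(4)] B1_def B2_def ball_Un ball_simps le
      by blast
  qed
qed

lemma adapted_root_region:
  assumes "finite V" "\<And>h. h \<in> V \<Longrightarrow> is_root h" "g \<in> V"
  shows "fan.adapted (root_region V g)"
proof -
  obtain B where B: "finite B" "root_region V g = {\<mu> \<in> N. \<forall>b\<in>B. 0 \<le> b \<bullet> \<mu>}"
    "\<forall>b\<in>B. b = 0 \<or> b \<in> normals"
    using root_region_halfspaces[OF assms] .
  have "b = 0 \<or> b \<in> normals \<or> - b \<in> normals" if "b \<in> B" for b using B(3) that by blast
  then show ?thesis unfolding B(2) by (rule fan.adapted_halfspaces)
qed

lemma polyhedral_cone_root_region:
  assumes "finite V" "\<And>h. h \<in> V \<Longrightarrow> is_root h" "g \<in> V"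
  shows "polyhedral_cone (root_region V g)"
proof -
  obtain B where B: "finite B" "root_region V g = {\<mu> \<in> N. \<forall>b\<in>B. 0 \<le> b \<bullet> \<mu>}"
    "\<forall>b\<in>B. b = 0 \<or> b \<in> normals"
    using root_region_halfspaces[OF assms] .
  have eq: "root_region V g = {\<mu> \<in> N. \<forall>b\<in>B. \<mu> \<bullet> 0 \<le> \<mu> \<bullet> b}"
    unfolding B(2) by (simp add: inner_commute)
  show ?thesis unfolding eq by (rule polyhedral_cone_halfspaces[OF polyhedral_cone_N B(1)])
qed

section \<open>Local compatible systems as unions of root regions\<close>

lemma LCS_conditions:
  assumes LCS: "local_compatible_system \<phi> v t C I"
  shows "1 \<le> t" "inj_on C {1..t}" "\<And>k. k \<in> {1..t} \<Longrightarrow> C k \<in> fan.fan_cones"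
    "\<And>k. k \<in> {1..t} \<Longrightarrow> fst (I k) \<in> Supp \<phi> \<and> snd (I k) \<in> Supp \<phi> \<and> fst (I k) \<noteq> snd (I k)"
    "\<And>k. k \<in> {1..t} \<Longrightarrow> primary_label \<phi> v (C k) (I k)"
    "\<And>a b. a \<in> {1..t} \<Longrightarrow> b \<in> {1..t} \<Longrightarrow> a \<noteq> b \<Longrightarrow> secondary_label \<phi> v (C a) (I a) (I b)"
    "\<And>f l D. l \<in> {1..t} \<Longrightarrow> f facet_of C l \<Longrightarrow> (\<And>k. k \<in> {1..t} \<Longrightarrow> f facet_of C k \<Longrightarrow> k = l) \<Longrightarrow>
       D \<in> fan.fan_cones \<Longrightarrow> D \<notin> C ` {1..t} \<Longrightarrow> f facet_of D \<Longrightarrow>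
       \<not> primary_label \<phi> v D (I l) \<or> (\<exists>b\<in>{1..t}. \<not> secondary_label \<phi> v D (I l) (I b))"
proof -
  note c = LCS[unfolded local_compatible_system_def maximal_cones_eq]
  have c3: "\<forall>k\<in>{1..t}. C k \<in> fan.fan_cones"
    and c4: "\<forall>k\<in>{1..t}. fst (I k) \<in> Supp \<phi> \<and> snd (I k) \<in> Supp \<phi> \<and> fst (I k) \<noteq> snd (I k)"
    and c5: "\<forall>k\<in>{1..t}. primary_label \<phi> v (C k) (I k)"
    and c6: "\<forall>a\<in>{1..t}. \<forall>b\<in>{1..t}. a \<noteq> b \<longrightarrow> secondary_label \<phi> v (C a) (I a) (I b)"
    and c7: "\<forall>f. \<forall>l\<in>{1..t}. f facet_of C l \<and> (\<forall>k\<in>{1..t}. f facet_of C k \<longrightarrow> k = l) \<longrightarrow>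
        (\<forall>D\<in>fan.fan_cones. D \<notin> C ` {1..t} \<and> f facet_of D \<longrightarrow>
           \<not> primary_label \<phi> v D (I l) \<or>
           (\<exists>b\<in>{1..t}. \<not> secondary_label \<phi> v D (I l) (I b)))"
    using c by - (elim conjE, assumption)+
  show "1 \<le> t" "inj_on C {1..t}" using c by - (elim conjE, assumption)+
  show "C k \<in> fan.fan_cones" if "k \<in> {1..t}" for k using c3 that by (rule bspec)
  show "fst (I k) \<in> Supp \<phi> \<and> snd (I k) \<in> Supp \<phi> \<and> fst (I k) \<noteq> snd (I k)" if "k \<in> {1..t}" for k
    using c4 that by (rule bspec)
  show "primary_label \<phi> v (C k) (I k)" if "k \<in> {1..t}" for k using c5 that by (rule bspec)
  show "secondary_label \<phi> v (C a) (I a) (I b)" if "a \<in> {1..t}" "b \<in> {1..t}" "a \<noteq> b" for a b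
    using c6[rule_format, OF that] .
  show "\<not> primary_label \<phi> v D (I l) \<or> (\<exists>b\<in>{1..t}. \<not> secondary_label \<phi> v D (I l) (I b))"
    if "l \<in> {1..t}" "f facet_of C l" "\<And>k. k \<in> {1..t} \<Longrightarrow> f facet_of C k \<Longrightarrow> k = l"
      "D \<in> fan.fan_cones" "D \<notin> C ` {1..t}" "f facet_of D" for f l D
  proof -
    have 1: "f facet_of C l \<and> (\<forall>k\<in>{1..t}. f facet_of C k \<longrightarrow> k = l)" using that(2,3) by simp
    have 2: "D \<notin> C ` {1..t} \<and> f facet_of D" using that(5,6) ..
    show ?thesis
      using c7[THEN spec[of _ f], THEN bspec[OF _ that(1)], THEN mp, OF 1, THEN bspec[OF _ that(4)], THEN mp, OF 2] .
  qed
qed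

lemma secondary_label_iff:
  "secondary_label \<phi> v C p q \<longleftrightarrow> (\<forall>\<mu>\<in>C. \<mu> \<bullet> rho_pair \<phi> v p \<le> \<mu> \<bullet> rho_pair \<phi> v q)"
  by (cases p, cases q) (simp add: secondary_label_def rho_pair_def)

lemma primary_label_pair_iff:
  assumes "fst p \<in> Supp \<phi> \<and> snd p \<in> Supp \<phi> \<and> fst p \<noteq> snd p" "C \<subseteq> N"
  shows "primary_label \<phi> v C p \<longleftrightarrow> C \<subseteq> root_cone \<phi> v (rho_pair \<phi> v p)"
  using primary_label_iff[of "fst p" "snd p" C] assms by (simp add: rho_pair_def case_prod_unfold)

lemma fan_cone_subset: "C \<in> fan.fan_cones \<Longrightarrow> C \<subseteq> N"
  by (erule fan.fan_cones_cases) simp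

text \<open>Turns conditions (2), (3) and (4) into statements about root regions. The comparison of
  an index with itself, which (3) leaves out, holds trivially.\<close>

lemma labels_iff:
  assumes p: "fst (I l) \<in> Supp \<phi> \<and> snd (I l) \<in> Supp \<phi> \<and> fst (I l) \<noteq> snd (I l)"
    and D: "D \<in> fan.fan_cones"
  shows "primary_label \<phi> v D (I l) \<and> (\<forall>b\<in>{1..t}. secondary_label \<phi> v D (I l) (I b)) \<longleftrightarrow>
    D \<subseteq> root_region (LCS_roots \<phi> v t I) (rho_pair \<phi> v (I l))"
proof -
  have "D \<subseteq> root_region (LCS_roots \<phi> v t I) (rho_pair \<phi> v (I l)) \<longleftrightarrow> D \<subseteq> root_cone \<phi> v (rho_pair \<phi> v (I l)) \<and>
      (\<forall>\<mu>\<in>D. \<forall>b\<in>{1..t}. \<mu> \<bullet> rho_pair \<phi> v (I l) \<le> \<mu> \<bullet> rho_pair \<phi> v (I b))"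
    by (simp add: root_region_def LCS_roots_image subset_iff ball_conj_distrib) blast
  moreover have "(\<forall>\<mu>\<in>D. \<forall>b\<in>{1..t}. \<mu> \<bullet> rho_pair \<phi> v (I l) \<le> \<mu> \<bullet> rho_pair \<phi> v (I b)) \<longleftrightarrow>
      (\<forall>b\<in>{1..t}. secondary_label \<phi> v D (I l) (I b))"
    unfolding secondary_label_iff by blast
  ultimately show ?thesis
    using primary_label_pair_iff[of "I l", OF p fan_cone_subset[OF D]] by simp
qed

lemma LCS_is_root:
  assumes LCS: "local_compatible_system \<phi> v t C I" and g: "g \<in> LCS_roots \<phi> v t I"
  shows "is_root g"
proof -
  obtain k where k: "k \<in> {1..t}" "g = rho_pair \<phi> v (I k)" using g by (auto simp: LCS_roots_def)
  then show ?thesis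
    using LCS_conditions(4)[OF LCS k(1)] by (auto simp: is_root_def rho_pair_def case_prod_unfold)
qed

lemma LCS_cone_eq_root_region:
  assumes LCS: "local_compatible_system \<phi> v t C I" and g: "g \<in> LCS_roots \<phi> v t I"
  shows "LCS_cone \<phi> v t C I g = root_region (LCS_roots \<phi> v t I) g"
proof -
  let ?V = "LCS_roots \<phi> v t I" and ?r = "\<lambda>k. rho_pair \<phi> v (I k)"
  note lcs = LCS_conditions[OF LCS]
  have rV: "?r k \<in> ?V" if "k \<in> {1..t}" for k using that by (auto simp: LCS_roots_def)
  have Csub: "C k \<subseteq> root_region ?V (?r k)" if k: "k \<in> {1..t}" for k
  proof -
    have "secondary_label \<phi> v (C k) (I k) (I b)" if "b \<in> {1..t}" for b
      using lcs(6)[OF k that] by (cases "b = k") (auto simp: secondary_label_iff)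
    then show ?thesis
      using labels_iff[where I = I and l = k and t = t, OF lcs(4)[OF k] lcs(3)[OF k]] lcs(5)[OF k] by simp
  qed
  let ?D = "root_region ?V g"
  define X where "X = C ` {k \<in> {1..t}. ?r k = g}"
  have Xeq: "LCS_cone \<phi> v t C I g = \<Union>X" by (auto simp: LCS_cone_def X_def)
  have XD: "\<Union>X \<subseteq> ?D" using Csub by (auto simp: X_def)
  have Xfan: "X \<subseteq> fan.fan_cones" using lcs(3) by (auto simp: X_def)
  obtain k0 where k0: "k0 \<in> {1..t}" "?r k0 = g" using g by (auto simp: LCS_roots_def)
  have C0: "C k0 \<in> X" "C k0 \<subseteq> ?D" using k0 Csub by (auto simp: X_def)
  have D: "fan.adapted ?D" using adapted_root_region[OF finite_LCS_roots LCS_is_root[OF LCS] g] .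
  have int: "interior ?D \<noteq> {}"
    using fan.interior_fan_cone_nonempty[OF lcs(3)[OF k0(1)]] interior_mono[OF C0(2)] by auto
  have all: "E \<in> X" if E: "E \<in> fan.fan_cones" "E \<subseteq> ?D" for E
  proof (rule ccontr)
    assume "E \<notin> X"
    then obtain K K' f where K: "K \<in> X" "K \<subseteq> ?D"
      and K': "K' \<in> fan.fan_cones" "K' \<notin> X" "K' \<subseteq> ?D"
      and f: "f facet_of K" "f facet_of K'"
      and two: "\<And>C''. C'' \<in> fan.fan_cones \<Longrightarrow> f facet_of C'' \<Longrightarrow> C'' = K \<or> C'' = K'"
      using fan.adjacent_cones[OF D Xfan C0 E(1) _ E(2)] by blast
    obtain l where l: "l \<in> {1..t}" "?r l = g" "K = C l" using K(1) by (auto simp: X_def)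
    \<comment> \<open>K' is known only to be missing among the cones with root g. Were it in the
      system with another root, it would lie in two root regions at once, contrary to full
      dimension.\<close>
    have nK': "K' \<notin> C ` {1..t}"
    proof
      assume "K' \<in> C ` {1..t}"
      then obtain m where m: "m \<in> {1..t}" "K' = C m" by blast
      then have "?r m = g"
        using root_region_unique[OF fan.interior_fan_cone_nonempty[OF K'(1)] _ K'(3) rV g] Csub by blast
      then show False using m K'(2) by (auto simp: X_def)
    qed
    \<comment> \<open>K and K' are the only fan cones with facet f, and K' is outside the system, so
      f belongs to a unique cone of it, as (4) requires.\<close>
    have "k = l" if "k \<in> {1..t}" "f facet_of C k" for k
    proof -
      have "C k = C l" using two[OF lcs(3) that(2)] that nK' l(3) by blast
      then show ?thesis using inj_onD[OF lcs(2)] that(1) l(1) by blast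
    qed
    then have "\<not> primary_label \<phi> v K' (I l) \<or> (\<exists>b\<in>{1..t}. \<not> secondary_label \<phi> v K' (I l) (I b))"
      using lcs(7)[OF l(1) f(1)[unfolded l(3)] _ K'(1) nK' f(2)] by blast
    then show False using labels_iff[where I = I and l = l and t = t, OF lcs(4)[OF l(1)] K'(1)] K'(3) l(2) by auto
  qed
  have "?D \<subseteq> \<Union>X" using fan.adapted_eq_Union[OF D int] all by blast
  then show ?thesis using XD Xeq by blast
qed

lemma LCS_support_eq:
  assumes "local_compatible_system \<phi> v t C I"
  shows "LCS_support t C = (\<Union>g\<in>LCS_roots \<phi> v t I. root_region (LCS_roots \<phi> v t I) g)"
proof -
  have "LCS_support t C = (\<Union>g\<in>LCS_roots \<phi> v t I. LCS_cone \<phi> v t C I g)"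
    by (fastforce simp: LCS_support_def LCS_roots_def LCS_cone_def)
  then show ?thesis using LCS_cone_eq_root_region[OF assms] by simp
qed

text \<open>Since the vertices are all the roots, the normal cones of P exhaust L, so N(P) = L. A
  competitor with a smaller recession cone has a normal support between L and the support of the
  system, and maximality of L forces equality.\<close>

lemma LCS_imp_MW_minimal:
  assumes LCS: "local_compatible_system \<phi> v t C I"
    and V: "vertices P = LCS_roots \<phi> v t I"
    and L: "maximal_convex_subcone (LCS_support t C) L"
    and P: "associated_polyhedron \<phi> v t C I L P"
  shows "MW_minimal_local_solution \<phi> v P"
proof -
  let ?V = "vertices P"
  have poly: "polyhedron P" using P by (simp add: associated_polyhedron_def)
  have ne: "?V \<noteq> {}" unfolding V using LCS_conditions(1)[OF LCS] by (auto simp: LCS_roots_def)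
  have NP: "inner_normal_cone P g = root_region ?V g \<inter> L" if g: "g \<in> ?V" for g
    using P that LCS_cone_eq_root_region[OF LCS g[unfolded V]] V
    unfolding associated_polyhedron_def by simp
  have Lsub: "L \<subseteq> (\<Union>g\<in>?V. root_region ?V g)"
    using L unfolding maximal_convex_subcone_def V LCS_support_eq[OF LCS] by blast
  have NL: "normal_support P = L"
    unfolding normal_support_def using NP Lsub by auto
  have sol: "local_solution \<phi> v P"
    using local_solution_if_normal_support_subset[OF poly ne] NL Lsub by blast
  have "recession_cone P' = recession_cone P"
    if P': "local_solution \<phi> v P'" "vertices P' = ?V" "recession_cone P' \<subseteq> recession_cone P" for P'
  proof -
    have poly': "polyhedron P'" using P'(1) by (simp add: local_solution_def is_solution_def)
    have ne': "vertices P' \<noteq> {}" using ne P'(2) by simp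
    have sub: "L \<subseteq> normal_support P'"
      using recession_cone_subset_iff[OF poly' ne' poly ne] P'(3) NL by simp
    have "normal_support P' \<subseteq> LCS_support t C"
      unfolding LCS_support_eq[OF LCS] V[symmetric] normal_support_def P'(2)[symmetric]
      using inner_normal_cone_root_region[OF P'(1)] by blast
    then have "normal_support P' = L"
      using L sub polyhedral_cone_normal_support[OF poly' ne'] unfolding maximal_convex_subcone_def by blast
    then have "recession_cone P \<subseteq> recession_cone P'"
      using recession_cone_subset_iff[OF poly ne poly' ne'] NL by simp
    then show ?thesis using P'(3) by blast
  qed
  then show ?thesis using sol by (simp add: MW_minimal_local_solution_def)
qed

text \<open>The system consists of all fan cones lying in some root region, each labelled by a pair
  for its root.\<close>

lemma LCS_of_root_regions:
  assumes V: "finite V" "V \<noteq> {}" "\<And>h. h \<in> V \<Longrightarrow> is_root h"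
    and full: "\<And>g. g \<in> V \<Longrightarrow> interior (root_region V g) \<noteq> {}"
  obtains t C I where "local_compatible_system \<phi> v t C I" "LCS_roots \<phi> v t I = V"
proof -
  let ?D = "root_region V"
  define \<C> where "\<C> = {K \<in> fan.fan_cones. \<exists>g\<in>V. K \<subseteq> ?D g}"
  have "finite \<C>" using fan.finite_fan_cones by (simp add: \<C>_def)
  then obtain C where C: "bij_betw C {1..card \<C>} \<C>" using ex_bij_betw_nat_finite_1 by blast
  let ?t = "card \<C>"
  have Cim: "C ` {1..?t} = \<C>" using C by (simp add: bij_betw_def)
  have "\<forall>K\<in>\<C>. \<exists>g. g \<in> V \<and> K \<subseteq> ?D g" by (auto simp: \<C>_def)
  then obtain \<gamma> where \<gamma>: "\<And>K. K \<in> \<C> \<Longrightarrow> \<gamma> K \<in> V \<and> K \<subseteq> ?D (\<gamma> K)" by metis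
  have "\<forall>g\<in>V. \<exists>p. (fst p \<in> Supp \<phi> \<and> snd p \<in> Supp \<phi> \<and> fst p \<noteq> snd p) \<and> rho_pair \<phi> v p = g"
  proof
    fix g assume "g \<in> V"
    then have "is_root g" by (rule V(3))
    then obtain i j where "i \<in> Supp \<phi>" "j \<in> Supp \<phi>" "i \<noteq> j" "g = rho \<phi> v i j"
      by (auto simp: is_root_def)
    then show "\<exists>p. (fst p \<in> Supp \<phi> \<and> snd p \<in> Supp \<phi> \<and> fst p \<noteq> snd p) \<and> rho_pair \<phi> v p = g"
      by (intro exI[of _ "(i, j)"]) (simp add: rho_pair_def)
  qed
  then obtain pr where pr: "\<And>g. g \<in> V \<Longrightarrow> (fst (pr g) \<in> Supp \<phi> \<and> snd (pr g) \<in> Supp \<phi> \<and> fst (pr g) \<noteq> snd (pr g)) \<and> rho_pair \<phi> v (pr g) = g"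
    by metis
  define I where "I k = pr (\<gamma> (C k))" for k
  have Ck: "C k \<in> \<C>" if "k \<in> {1..?t}" for k using that Cim by blast
  have Cfan: "C k \<in> fan.fan_cones" if "k \<in> {1..?t}" for k using Ck[OF that] by (simp add: \<C>_def)
  have I: "fst (I k) \<in> Supp \<phi> \<and> snd (I k) \<in> Supp \<phi> \<and> fst (I k) \<noteq> snd (I k)" "rho_pair \<phi> v (I k) = \<gamma> (C k)"
    if "k \<in> {1..?t}" for k
    using pr[OF conjunct1[OF \<gamma>[OF Ck[OF that]]]] by (simp_all add: I_def)
  have \<gamma>_unique: "\<gamma> K = g" if "K \<in> fan.fan_cones" "K \<subseteq> ?D g" "g \<in> V" for K g
  proof -
    have "K \<in> \<C>" using that by (auto simp: \<C>_def)
    then show ?thesis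
      using root_region_unique[OF fan.interior_fan_cone_nonempty[OF that(1)] _ that(2) _ that(3)] \<gamma> by blast
  qed
  have D_Union: "?D g = \<Union>{K \<in> fan.fan_cones. K \<subseteq> ?D g}" if "g \<in> V" for g
    using fan.adapted_eq_Union[OF adapted_root_region[OF V(1,3) that] full[OF that]] .
  have cone: "LCS_cone \<phi> v ?t C I g = ?D g" if g: "g \<in> V" for g
  proof -
    have "{C k | k. k \<in> {1..?t} \<and> rho_pair \<phi> v (I k) = g} = {K \<in> fan.fan_cones. K \<subseteq> ?D g}"
    proof (intro subset_antisym subsetI)
      fix K assume "K \<in> {C k | k. k \<in> {1..?t} \<and> rho_pair \<phi> v (I k) = g}"
      then obtain k where k: "k \<in> {1..?t}" "K = C k" "rho_pair \<phi> v (I k) = g" by blast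
      then show "K \<in> {K \<in> fan.fan_cones. K \<subseteq> ?D g}"
        using I(2)[OF k(1)] Cfan[OF k(1)] \<gamma>[OF Ck[OF k(1)]] by simp
    next
      fix K assume K: "K \<in> {K \<in> fan.fan_cones. K \<subseteq> ?D g}"
      then have "K \<in> \<C>" using g by (auto simp: \<C>_def)
      then obtain k where "k \<in> {1..?t}" "K = C k" using Cim by blast
      then show "K \<in> {C k | k. k \<in> {1..?t} \<and> rho_pair \<phi> v (I k) = g}"
        using I(2) \<gamma>_unique K g by auto
    qed
    then show ?thesis unfolding LCS_cone_def using D_Union[OF g] by simp
  qed
  have roots: "LCS_roots \<phi> v ?t I = V"
  proof (intro subset_antisym subsetI)
    fix g assume "g \<in> LCS_roots \<phi> v ?t I"
    then obtain k where k: "k \<in> {1..?t}" "g = rho_pair \<phi> v (I k)" by (auto simp: LCS_roots_def)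
    then show "g \<in> V" using I(2) \<gamma>[OF Ck] by simp
  next
    fix g assume g: "g \<in> V"
    have "?D g \<noteq> {}" using full[OF g] interior_subset by blast
    then obtain k where "k \<in> {1..?t}" "rho_pair \<phi> v (I k) = g"
      using cone[OF g] unfolding LCS_cone_def by blast
    then show "g \<in> LCS_roots \<phi> v ?t I" by (auto simp: LCS_roots_def)
  qed
  have lab: "primary_label \<phi> v (C k) (I k) \<and> (\<forall>b\<in>{1..?t}. secondary_label \<phi> v (C k) (I k) (I b))"
    if k: "k \<in> {1..?t}" for k
    unfolding labels_iff[where I = I and l = k, OF I(1)[OF k] Cfan[OF k]] roots I(2)[OF k]
    using \<gamma>[OF Ck[OF k]] by simp
  \<comment> \<open>Stronger than (4): a cone outside the system lacks the labels whether or not it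
    shares a facet.\<close>
  have nolab: "\<not> primary_label \<phi> v K (I l) \<or> (\<exists>b\<in>{1..?t}. \<not> secondary_label \<phi> v K (I l) (I b))"
    if K: "K \<in> fan.fan_cones" "K \<notin> C ` {1..?t}" and l: "l \<in> {1..?t}" for K l
  proof (rule ccontr)
    assume "\<not> ?thesis"
    then have "K \<subseteq> ?D (\<gamma> (C l))"
      using labels_iff[where I = I and l = l and t = ?t, OF I(1)[OF l] K(1)] I(2)[OF l] roots by auto
    then show False using K \<gamma>[OF Ck[OF l]] unfolding Cim by (auto simp: \<C>_def)
  qed
  have "\<C> \<noteq> {}" using roots V(2) \<open>finite \<C>\<close> by (auto simp: LCS_roots_def)
  then have "1 \<le> ?t" using \<open>finite \<C>\<close> by (simp add: Suc_leI card_gt_0_iff)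
  then have "local_compatible_system \<phi> v ?t C I"
    unfolding local_compatible_system_def maximal_cones_eq roots
  proof (intro conjI)
    show "1 \<le> ?t" by fact
    show "inj_on C {1..?t}" using C by (rule bij_betw_imp_inj_on)
    show "\<forall>k\<in>{1..?t}. C k \<in> fan.fan_cones" using Cfan ..
    show "\<forall>k\<in>{1..?t}. fst (I k) \<in> Supp \<phi> \<and> snd (I k) \<in> Supp \<phi> \<and> fst (I k) \<noteq> snd (I k)"
      using I(1) ..
    show "\<forall>g\<in>V. polyhedral_cone (LCS_cone \<phi> v ?t C I g)"
    proof
      fix g assume "g \<in> V"
      then show "polyhedral_cone (LCS_cone \<phi> v ?t C I g)"
        using polyhedral_cone_root_region[OF V(1,3)] by (simp only: cone)
    qed
    show "\<forall>k\<in>{1..?t}. primary_label \<phi> v (C k) (I k)" using conjunct1[OF lab] ..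
    show "\<forall>a\<in>{1..?t}. \<forall>b\<in>{1..?t}. a \<noteq> b \<longrightarrow> secondary_label \<phi> v (C a) (I a) (I b)"
      using bspec[OF conjunct2[OF lab]] by (intro ballI impI)
    show "\<forall>f. \<forall>l\<in>{1..?t}. f facet_of C l \<and> (\<forall>k\<in>{1..?t}. f facet_of C k \<longrightarrow> k = l) \<longrightarrow>
        (\<forall>D\<in>fan.fan_cones. D \<notin> C ` {1..?t} \<and> f facet_of D \<longrightarrow>
           \<not> primary_label \<phi> v D (I l) \<or> (\<exists>b\<in>{1..?t}. \<not> secondary_label \<phi> v D (I l) (I b)))"
    proof (intro allI ballI impI)
      fix f l D
      assume "l \<in> {1..?t}" "D \<in> fan.fan_cones" "D \<notin> C ` {1..?t} \<and> f facet_of D"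
      then show "\<not> primary_label \<phi> v D (I l) \<or> (\<exists>b\<in>{1..?t}. \<not> secondary_label \<phi> v D (I l) (I b))"
        using nolab by (elim conjE)
    qed
  qed
  then show thesis using roots by (rule that)
qed

text \<open>The subcone is L = N(P). A larger polyhedral cone L' in the support would be the normal
  support of a solution with the same vertices and a smaller recession cone, so minimality of P
  gives maximality of L.\<close>

lemma MW_minimal_imp_LCS:
  assumes min: "MW_minimal_local_solution \<phi> v P"
  obtains t C I L where "local_compatible_system \<phi> v t C I" "LCS_roots \<phi> v t I = vertices P"
    "maximal_convex_subcone (LCS_support t C) L" "associated_polyhedron \<phi> v t C I L P"
proof -
  let ?V = "vertices P" and ?L = "normal_support P"
  have sol: "local_solution \<phi> v P" using min by (simp add: MW_minimal_local_solution_def)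
  have P: "polyhedron P" "?V \<noteq> {}" using sol by (auto simp: local_solution_def is_solution_def)
  have V: "finite ?V" using finite_vertices[OF P(1)] .
  have sub: "inner_normal_cone P g \<subseteq> root_region ?V g" if "g \<in> ?V" for g
    using inner_normal_cone_root_region[OF sol that] .
  have full: "interior (root_region ?V g) \<noteq> {}" if "g \<in> ?V" for g
    using interior_inner_normal_cone_nonempty[OF P(1) that] interior_mono[OF sub[OF that]] by auto
  have root: "is_root g" if g: "g \<in> ?V" for g
  proof -
    have "root_cone \<phi> v g \<noteq> {}" using full[OF g] interior_subset root_region_subset(1) by blast
    then show ?thesis unfolding root_cone_def is_root_def by blast
  qed
  obtain t C I where LCS: "local_compatible_system \<phi> v t C I" and roots: "LCS_roots \<phi> v t I = ?V"
    using LCS_of_root_regions[OF V P(2) root full] by blast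
  have supp: "LCS_support t C = (\<Union>g\<in>?V. root_region ?V g)"
    using LCS_support_eq[OF LCS] roots by simp
  have cone: "LCS_cone \<phi> v t C I g \<inter> ?L = inner_normal_cone P g" if g: "g \<in> ?V" for g
  proof -
    have "LCS_cone \<phi> v t C I g = root_region ?V g" using LCS_cone_eq_root_region[OF LCS] roots g by simp
    then show ?thesis
      using sub[OF g] unfolding inner_normal_cone_vertex[OF g] root_region_def by blast
  qed
  have "maximal_convex_subcone (LCS_support t C) ?L"
    unfolding maximal_convex_subcone_def
  proof (intro conjI allI impI)
    show "polyhedral_cone ?L" using polyhedral_cone_normal_support[OF P] .
    show "?L \<subseteq> LCS_support t C" unfolding supp normal_support_def using sub by blast
    fix L' assume L': "polyhedral_cone L' \<and> ?L \<subseteq> L' \<and> L' \<subseteq> LCS_support t C"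
    \<comment> \<open>Enlarging N(P) to L' only enlarges the cone on which g is minimal, so every g
      remains a vertex.\<close>
    have full': "interior {l \<in> L'. \<forall>h\<in>?V. l \<bullet> g \<le> l \<bullet> h} \<noteq> {}" if g: "g \<in> ?V" for g
    proof -
      have "inner_normal_cone P g \<subseteq> {l \<in> L'. \<forall>h\<in>?V. l \<bullet> g \<le> l \<bullet> h}"
        unfolding inner_normal_cone_vertex[OF g] using L' by blast
      from interior_mono[OF this] show ?thesis using interior_inner_normal_cone_nonempty[OF P(1) g] by auto
    qed
    obtain P' where P': "polyhedron P'" "vertices P' = ?V" "normal_support P' = L'"
      using polyhedron_with_normal_fan[OF V P(2) conjunct1[OF L'] full'] .
    have ne': "vertices P' \<noteq> {}" using P' P by simp
    have "local_solution \<phi> v P'"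
      using local_solution_if_normal_support_subset[OF P'(1) ne'] P'(2,3) L' supp by simp
    moreover have "recession_cone P' \<subseteq> recession_cone P"
      using recession_cone_subset_iff[OF P'(1) ne' P] P'(3) L' by blast
    ultimately have "recession_cone P' = recession_cone P"
      using min P'(2) unfolding MW_minimal_local_solution_def by blast
    then show "L' = ?L"
      using recession_cone_subset_iff[OF P'(1) ne' P] recession_cone_subset_iff[OF P P'(1) ne'] P'(3) by blast
  qed
  moreover have "associated_polyhedron \<phi> v t C I ?L P"
  proof -
    have "full_dimensional (inner_normal_cone P g)" if g: "g \<in> ?V" for g
      using full_dimensional_iff[OF polyhedral_cone_convex[OF polyhedral_cone_inner_normal_cone[OF P(1) g]]]
        interior_inner_normal_cone_nonempty[OF P(1) g] by blast
    then have "restricted_roots \<phi> v t C I ?L = ?V"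
      unfolding restricted_roots_def roots using cone by auto
    then show ?thesis unfolding associated_polyhedron_def using P(1) cone by simp
  qed
  ultimately show thesis using that LCS roots by blast
qed

end

lemma rational_polyhedron_imp_polyhedron:
  fixes P :: "(real^'n) set"
  assumes "rational_polyhedron P"
  shows "polyhedron P"
proof -
  obtain F :: "((real^'n) \<times> real) set" where F: "finite F" "P = {x. \<forall>(a, b)\<in>F. a \<bullet> x \<le> b}"
    using assms unfolding rational_polyhedron_def by blast
  have "P = (\<Inter>(a, b)\<in>F. {x. a \<bullet> x \<le> b})" unfolding F(2) by auto
  moreover have "polyhedron (case p of (a, b) \<Rightarrow> {x. a \<bullet> x \<le> b})" for p :: "(real^'n) \<times> real"
    by (cases p) (simp add: polyhedron_halfspace_le)
  ultimately show ?thesis using F(1) by (auto intro: polyhedron_Inter)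
qed

theorem theorem1p1:
  fixes \<omega> :: "real^'n"
    and A :: "(real^'n) set ring"
    and \<phi> :: "nat \<Rightarrow> (real^'n) set"
    and v :: "real^'n"
    and P\<^sub>0 V :: "(real^'n) set"
  assumes "rationally_independent \<omega>"
    and "polyhedral_semiring \<omega> A"
    and "polyhedral_polynomial A \<phi>"
    and "generic \<phi>"
    and "v \<in> vertices (coeff_sum \<phi>)"
    and "polyhedron P\<^sub>0"
    and "vertices P\<^sub>0 = V"
  shows "MW_minimal_local_solution \<phi> v P\<^sub>0 \<longleftrightarrow>
    (\<exists>t C I. local_compatible_system \<phi> v t C I \<and>
       V = LCS_roots \<phi> v t I \<and>
       (\<exists>L. maximal_convex_subcone (LCS_support t C) L \<and>
            associated_polyhedron \<phi> v t C I L P\<^sub>0))"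
proof -
  have "polyhedron (\<phi> i)" if "i \<in> Supp \<phi>" for i
  proof -
    have "\<phi> i \<in> carrier (omega_semiring \<omega>)"
      using assms(2,3) by (auto simp: polyhedral_semiring_def polyhedral_polynomial_def)
    then show ?thesis
      using that by (auto simp: omega_semiring_def Supp_def intro: rational_polyhedron_imp_polyhedron)
  qed
  moreover have "finite (Supp \<phi>)" "2 \<le> card (Supp \<phi>)"
    using assms(3) by (simp_all add: polyhedral_polynomial_def)
  ultimately interpret generic_coeff_sum_vertex \<phi> v
    using assms(4,5) by unfold_locales
  show ?thesis
    using LCS_imp_MW_minimal MW_minimal_imp_LCS assms(7) by metis
qed

end
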